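(* Let $n \ge 3$ and $u\in \mathbb{S}^{n-1}$. Let $K,L\subset\mathbb{R}^n$ be convex bodies such that $P_{u^\perp}(K),P_{u^\perp}(L)\subset u^\perp$ are homothetic $(n-1)$-dimensional convex bodies. Then $$\frac{\mathcal{H}^n(K+L)}{\mathcal{H}^{n-1}(P_{u^\perp}(K+L))}\geq \frac{\mathcal{H}^n(K)}{\mathcal{H}^{n-1}(P_{u^\perp}(K))}+ \frac{\mathcal{H}^n(L)}{\mathcal{H}^{n-1}(P_{u^\perp}(L))}.\qquad ( * )$$ Moreover, for every $n \ge 3$, there are two convex bodies $K,L\subset\mathbb{R}^n$ with nonempty interior and a direction $u\in \mathbb{S}^{n-1}$ such that $\mathcal{H}^{n-1}(P_{u^\perp}(K))=\mathcal{H}^{n-1}(P_{u^\perp}(L)) \ne 0$, for which inequality $( * )$ fails.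
   Context: A convex body is a nonempty compact convex subset of $\mathbb{R}^n$; its dimension is that of its affine hull. $\mathcal{H}^k$ is the $k$-dimensional Hausdorff measure. $\mathbb{S}^{n-1}$ is the Euclidean unit sphere, $u^\perp$ is the hyperplane through the origin orthogonal to $u$, and $P_{u^\perp}$ is the orthogonal projection onto $u^\perp$. $K+L=\{a+b: a\in K, b\in L\}$ is the Minkowski sum. Two sets $A,B$ are homothetic if $A=\lambda B+a$ for some $\lambda>0$ and $a\in\mathbb{R}^n$. *)

theory Defs
  imports "HOL-Analysis.Analysis"
begin

text \<open>
  Hausdorff measure with the usual normalisation, under which the \<open>n\<close>-dimensional measure on
  \<open>n\<close>-dimensional Euclidean space agrees with Lebesgue measure: a covering set of diameter \<open>d\<close>
  is charged the volume of a \<open>k\<close>-dimensional ball of radius \<open>d / 2\<close>.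
  The case distinction matters only for \<open>k = 0\<close>, because \<open>0 ^ 0 = 1\<close>. Boundedness is required
  explicitly because \<^const>\<open>diameter\<close> is an unspecified real number on unbounded sets.
\<close>

definition hausdorff_gauge :: "nat \<Rightarrow> 'a::metric_space set \<Rightarrow> ennreal" where
  "hausdorff_gauge k U =
    (if U = {} then 0 else ennreal (unit_ball_vol (real k) * (diameter U / 2) ^ k))"

definition hausdorff_content :: "nat \<Rightarrow> real \<Rightarrow> 'a::metric_space set \<Rightarrow> ennreal" where
  "hausdorff_content k \<delta> A =
    (INF U \<in> {U :: nat \<Rightarrow> 'a set. A \<subseteq> (\<Union>i. U i) \<and> (\<forall>i. bounded (U i) \<and> diameter (U i) \<le> \<delta>)}.
      \<Sum>i. hausdorff_gauge k (U i))"

definition hausdorff_measure :: "nat \<Rightarrow> 'a::metric_space set \<Rightarrow> ennreal" where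
  "hausdorff_measure k A = (SUP \<delta> \<in> {0<..}. hausdorff_content k \<delta> A)"

definition convex_body :: "'a::euclidean_space set \<Rightarrow> bool" where
  "convex_body K \<longleftrightarrow> K \<noteq> {} \<and> compact K \<and> convex K"

definition homothetic_sets :: "'a::real_vector set \<Rightarrow> 'a set \<Rightarrow> bool" where
  "homothetic_sets A B \<longleftrightarrow> (\<exists>c a. c > 0 \<and> A = (\<lambda>x. c *\<^sub>R x + a) ` B)"

definition perp_space :: "'a::real_inner \<Rightarrow> 'a set" where
  "perp_space u = {x. u \<bullet> x = 0}"

text \<open>The orthogonal projection onto a closed subspace is the nearest-point map.\<close>

definition perp_proj :: "'a::euclidean_space \<Rightarrow> 'a \<Rightarrow> 'a" where
  "perp_proj u = closest_point (perp_space u)"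

lemma perp_proj_unit:
  assumes "norm u = 1"
  shows "perp_proj u x = x - (u \<bullet> x) *\<^sub>R u"
proof -
  define p where "p = x - (u \<bullet> x) *\<^sub>R u"
  have uu: "u \<bullet> u = 1"
    using assms by (simp add: dot_square_norm)
  have p: "p \<in> perp_space u"
    by (simp add: p_def perp_space_def inner_diff_right uu)
  have "dist x p \<le> dist x y" if "y \<in> perp_space u" for y
  proof -
    have xp: "x - p = (u \<bullet> x) *\<^sub>R u"
      by (simp add: p_def)
    have "orthogonal (x - p) (p - y)"
      using p that unfolding xp by (simp add: orthogonal_def perp_space_def inner_diff_right)
    then have "(norm ((x - p) + (p - y)))\<^sup>2 = (norm (x - p))\<^sup>2 + (norm (p - y))\<^sup>2"
      by (rule norm_add_Pythagorean)
    then have "(norm (x - p))\<^sup>2 \<le> (norm (x - y))\<^sup>2"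
      by simp
    then show ?thesis
      by (simp add: dist_norm power2_le_iff_abs_le)
  qed
  moreover have "convex (perp_space u)" "closed (perp_space u)"
    by (simp_all add: perp_space_def convex_hyperplane closed_hyperplane)
  ultimately have "p = closest_point (perp_space u) x"
    using p by (intro closest_point_unique) auto
  then show ?thesis
    by (simp add: perp_proj_def p_def)
qed

end

(* The inequality is fibrewise: if the projections are homothetic, P K = c P L + a, then the chord of
   K + L over (1 + c) z + a contains the sum of the chords of K over c z + a and of L over z, and
   integrating over z gives the claim. Fubini in an arbitrary direction u is obtained without
   choosing coordinates by integrating over a slab {x. 0 <= u . x <= h}. The dimension constants
   relating Hausdorff and Lebesgue measure cancel in the inequality, so it suffices that on each
   coordinate subspace the two are proportional with a positive finite factor; no isodiametric
   inequality is needed.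

   For the counterexample, L is a pyramid whose horizontal sections in one direction are long exactly
   where L is high, and K is a flat box, long in that direction and with the same base area. Adding K
   makes the lengths of these sections almost equal, so the high part of L loses weight: the mean
   height drops from 1 + 2/3 = 65/39 to 64/39. *)
theory Submission
  imports Defs
begin

section \<open>Hausdorff measure as an outer measure\<close>

text \<open>The comparison of Hausdorff with Lebesgue measure concerns an arbitrary compact subset
  of a coordinate subspace, with only monotonicity, countable subadditivity and scaling of Hausdorff
  measure at hand. A volume for such a set is obtained by thickening it with a unit cube in the
  missing coordinates. Covering the thickened set by cubes and averaging over parallel sections
  bounds the Hausdorff measure from above; the same bound for the complement in a large cube, whose
  measure is known by scaling, gives the bound from below.

  The constants of the counterexample balance two effects. Let \<open>y\<close> be the coordinate
  along which length and height of \<open>L\<close> both equal \<open>y\<close>. A box of height 1,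
  base area 1/2 and width 1/4 in that direction must have length 2. Adding it changes the weight
  \<open>y\<close> to \<open>2 + y\<close> on [0, 1], which lowers the mean of \<open>y\<close> from
  2/3 to 8/15, but it also creates a plateau of width 1/4 at full height, which raises that mean to
  25/39. This is still below 26/39 = 2/3: the small width keeps the plateau from outweighing the
  loss.\<close>

lemma hausdorff_content_le:
  assumes "A \<subseteq> (\<Union>i. U i)" "\<And>i. bounded (U i)" "\<And>i. diameter (U i) \<le> \<delta>"
  shows "hausdorff_content k \<delta> A \<le> (\<Sum>i. hausdorff_gauge k (U i))"
  unfolding hausdorff_content_def by (rule INF_lower) (use assms in auto)

lemma hausdorff_content_mono: "A \<subseteq> B \<Longrightarrow> hausdorff_content k \<delta> A \<le> hausdorff_content k \<delta> B"
  unfolding hausdorff_content_def by (rule INF_superset_mono) auto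

lemma hausdorff_content_approx:
  assumes "hausdorff_content k \<delta> A < y"
  obtains U where "A \<subseteq> (\<Union>i. U i)" "\<And>i::nat. bounded (U i)" "\<And>i. diameter (U i) \<le> \<delta>"
    "(\<Sum>i. hausdorff_gauge k (U i)) < y"
  using assms unfolding hausdorff_content_def INF_less_iff by auto

lemma hausdorff_content_UN:
  "hausdorff_content k \<delta> (\<Union>i::nat. A i) \<le> (\<Sum>i. hausdorff_content k \<delta> (A i))"
proof (rule ennreal_le_epsilon)
  fix e :: real
  assume fin: "(\<Sum>i. hausdorff_content k \<delta> (A i)) < top" and e: "0 < e"
  have "\<exists>U::nat \<Rightarrow> 'a set. A i \<subseteq> (\<Union>j. U j) \<and> (\<forall>j. bounded (U j) \<and> diameter (U j) \<le> \<delta>) \<and>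
    (\<Sum>j. hausdorff_gauge k (U j)) \<le> hausdorff_content k \<delta> (A i) + ennreal (e * (1/2) ^ Suc i)" for i
  proof -
    \<comment> \<open>Finiteness makes the next inequality strict: in \<open>ennreal\<close>, adding
      a positive number does not enlarge \<open>top\<close>.\<close>
    have "hausdorff_content k \<delta> (A i) < top"
      using fin by (rule ennreal_suminf_lessD)
    then have "hausdorff_content k \<delta> (A i) < hausdorff_content k \<delta> (A i) + ennreal (e * (1/2) ^ Suc i)"
      using e by (simp add: ennreal_add_left_cancel_less[of _ 0, simplified] del: power_Suc)
    then obtain U where "A i \<subseteq> (\<Union>i. U i)" "\<And>i::nat. bounded (U i)" "\<And>i. diameter (U i) \<le> \<delta>"
      "(\<Sum>j. hausdorff_gauge k (U j)) < hausdorff_content k \<delta> (A i) + ennreal (e * (1/2) ^ Suc i)"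
      using hausdorff_content_approx by blast
    then show ?thesis
      by (auto intro!: exI[of _ U])
  qed
  then obtain U :: "nat \<Rightarrow> nat \<Rightarrow> 'a set" where
    U: "\<And>i. A i \<subseteq> (\<Union>j. U i j)" "\<And>i j. bounded (U i j)" "\<And>i j. diameter (U i j) \<le> \<delta>"
    and le: "\<And>i. (\<Sum>j. hausdorff_gauge k (U i j)) \<le> hausdorff_content k \<delta> (A i) + ennreal (e * (1/2) ^ Suc i)"
    by metis
  have "hausdorff_content k \<delta> (\<Union>i. A i) \<le> (\<Sum>n. hausdorff_gauge k (case_prod U (prod_decode n)))"
  proof (rule hausdorff_content_le)
    show "(\<Union>i. A i) \<subseteq> (\<Union>n. case_prod U (prod_decode n))"
    proof
      fix x assume "x \<in> (\<Union>i. A i)"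
      then obtain i j where "x \<in> U i j"
        using U(1) by blast
      then show "x \<in> (\<Union>n. case_prod U (prod_decode n))"
        by (intro UN_I[of "prod_encode (i, j)"]) auto
    qed
  qed (use U in \<open>auto split: prod.split\<close>)
  also have "\<dots> = (\<Sum>i. \<Sum>j. hausdorff_gauge k (U i j))"
    using suminf_ennreal_2dimen[of "\<lambda>m. \<Sum>n. hausdorff_gauge k (U m n)" "\<lambda>p. hausdorff_gauge k (case_prod U p)"]
    by simp
  also have "\<dots> \<le> (\<Sum>i. hausdorff_content k \<delta> (A i) + ennreal (e * (1/2) ^ Suc i))"
    by (intro suminf_le le summableI)
  also have "\<dots> = (\<Sum>i. hausdorff_content k \<delta> (A i)) + (\<Sum>i. ennreal (e * (1/2) ^ Suc i))"
    by (rule suminf_add[symmetric]) (rule summableI)+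
  also have "(\<Sum>i. ennreal (e * (1/2) ^ Suc i)) = ennreal e"
    using sums_mult[OF power_half_series, of e] e
    by (intro sums_unique[symmetric]) (auto intro!: sums_ennreal[THEN iffD2] simp del: power_Suc)
  finally show "hausdorff_content k \<delta> (\<Union>i. A i) \<le> (\<Sum>i. hausdorff_content k \<delta> (A i)) + ennreal e" .
qed

lemma hausdorff_measure_mono: "A \<subseteq> B \<Longrightarrow> hausdorff_measure k A \<le> hausdorff_measure k B"
  unfolding hausdorff_measure_def by (intro SUP_mono') (rule hausdorff_content_mono)

lemma hausdorff_content_le_measure: "0 < \<delta> \<Longrightarrow> hausdorff_content k \<delta> A \<le> hausdorff_measure k A"
  unfolding hausdorff_measure_def by (rule SUP_upper) auto

lemma hausdorff_measure_UN:
  "hausdorff_measure k (\<Union>i::nat. A i) \<le> (\<Sum>i. hausdorff_measure k (A i))"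
  unfolding hausdorff_measure_def[of k "\<Union>i. A i"]
proof (rule SUP_least)
  fix \<delta> :: real assume "\<delta> \<in> {0<..}"
  then have "hausdorff_content k \<delta> (\<Union>i. A i) \<le> (\<Sum>i. hausdorff_content k \<delta> (A i))"
    "\<And>i. hausdorff_content k \<delta> (A i) \<le> hausdorff_measure k (A i)"
    by (auto intro: hausdorff_content_UN hausdorff_content_le_measure)
  then show "hausdorff_content k \<delta> (\<Union>i. A i) \<le> (\<Sum>i. hausdorff_measure k (A i))"
    by (meson order_trans suminf_le summableI)
qed

lemma hausdorff_content_empty: "0 \<le> \<delta> \<Longrightarrow> hausdorff_content k \<delta> {} = 0"
  using hausdorff_content_le[of "{}" "\<lambda>_. {}" \<delta> k] by (simp add: hausdorff_gauge_def)

lemma hausdorff_measure_empty [simp]: "hausdorff_measure k {} = 0"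
  unfolding hausdorff_measure_def
  by (subst SUP_cong[OF refl hausdorff_content_empty]) auto

lemma hausdorff_measure_Un:
  "hausdorff_measure k (A \<union> B) \<le> hausdorff_measure k A + hausdorff_measure k B"
proof -
  let ?S = "\<lambda>i::nat. if i = 0 then A else if i = 1 then B else {}"
  have "hausdorff_measure k (\<Union>i. ?S i) \<le> (\<Sum>i. hausdorff_measure k (?S i))"
    by (rule hausdorff_measure_UN)
  also have "\<dots> = (\<Sum>i<2. hausdorff_measure k (?S i))"
    by (rule suminf_finite) auto
  also have "\<dots> = hausdorff_measure k A + hausdorff_measure k B"
    by (simp add: numeral_2_eq_2)
  also have "(\<Union>i. ?S i) = A \<union> B"
    by (auto split: if_splits)
  finally show ?thesis .
qed

section \<open>Hausdorff measure under Lipschitz maps and similarities\<close>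

lemma hausdorff_content_Lipschitz:
  fixes f :: "'a::metric_space \<Rightarrow> 'b::metric_space"
  assumes lip: "\<And>x y. dist (f x) (f y) \<le> s * dist x y" and s: "0 < s"
  shows "hausdorff_content k (s * \<delta>) (f ` A) \<le> ennreal (s ^ k) * hausdorff_content k \<delta> A"
proof -
  let ?c = "ennreal (s ^ k)"
  have c: "0 < ?c" "?c < top" using s by auto
  \<comment> \<open>The factor stands on the left as a divisor, so that an estimate for each single
    cover bounds the infimum directly; it is multiplied back at the end.\<close>
  have "hausdorff_content k (s * \<delta>) (f ` A) / ?c \<le> hausdorff_content k \<delta> A"
    unfolding hausdorff_content_def[of k \<delta> A]
  proof (rule INF_greatest)
    fix U :: "nat \<Rightarrow> 'a set"
    assume "U \<in> {U. A \<subseteq> (\<Union>i. U i) \<and> (\<forall>i. bounded (U i) \<and> diameter (U i) \<le> \<delta>)}"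
    then have U: "A \<subseteq> (\<Union>i. U i)" "\<And>i. bounded (U i)" "\<And>i. diameter (U i) \<le> \<delta>"
      by auto
    have dist: "dist (f x) (f y) \<le> s * diameter (U i)" if "x \<in> U i" "y \<in> U i" for x y i
      using lip[of x y] mult_left_mono[OF diameter_bounded_bound[OF U(2) that], of s] s by linarith
    have diam: "diameter (f ` U i) \<le> s * diameter (U i)" for i
    proof (cases "U i = {}")
      case False
      have "(SUP (x, y) \<in> f ` U i \<times> f ` U i. dist x y) \<le> s * diameter (U i)"
        using False dist by (intro cSUP_least) auto
      then show ?thesis
        using False unfolding diameter_def[of "f ` U i"] by simp
    qed (simp add: diameter_def)
    have bdd: "bounded (f ` U i)" for i
      using dist unfolding bounded_two_points by blast
    have gauge: "hausdorff_gauge k (f ` U i) \<le> ?c * hausdorff_gauge k (U i)" for i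
    proof (cases "U i = {}")
      case False
      have "(diameter (f ` U i) / 2) ^ k \<le> (s * diameter (U i) / 2) ^ k"
        using diam[of i] diameter_ge_0[OF bdd[of i]] by (intro power_mono) auto
      then have "unit_ball_vol (real k) * (diameter (f ` U i) / 2) ^ k
          \<le> unit_ball_vol (real k) * (s * diameter (U i) / 2) ^ k"
        by (intro mult_left_mono) auto
      also have "\<dots> = s ^ k * (unit_ball_vol (real k) * (diameter (U i) / 2) ^ k)"
        by (simp add: power_mult_distrib power_divide)
      finally show ?thesis
        using False s diameter_ge_0[OF U(2)[of i]]
        by (simp add: hausdorff_gauge_def ennreal_mult'[symmetric] ennreal_leI)
    qed (simp add: hausdorff_gauge_def)
    have "hausdorff_content k (s * \<delta>) (f ` A) \<le> (\<Sum>i. hausdorff_gauge k (f ` U i))"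
    proof (intro hausdorff_content_le bdd)
      show "f ` A \<subseteq> (\<Union>i. f ` U i)"
        using U(1) by blast
      show "diameter (f ` U i) \<le> s * \<delta>" for i
        using diam[of i] U(3)[of i] s by (meson mult_left_mono order_trans less_imp_le)
    qed
    also have "\<dots> \<le> (\<Sum>i. ?c * hausdorff_gauge k (U i))"
      by (intro suminf_le gauge summableI)
    also have "\<dots> = ?c * (\<Sum>i. hausdorff_gauge k (U i))"
      by simp
    finally show "hausdorff_content k (s * \<delta>) (f ` A) / ?c \<le> (\<Sum>i. hausdorff_gauge k (U i))"
      using c by (intro divide_le_posI_ennreal)
  qed
  then have "?c * (hausdorff_content k (s * \<delta>) (f ` A) / ?c) \<le> ?c * hausdorff_content k \<delta> A"
    by (rule mult_left_mono) simp
  moreover have "?c * (hausdorff_content k (s * \<delta>) (f ` A) / ?c) = hausdorff_content k (s * \<delta>) (f ` A)"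
    unfolding ennreal_times_divide mult.commute[of ?c]
    using s by (intro mult_divide_eq_ennreal) auto
  ultimately show ?thesis by simp
qed

lemma hausdorff_measure_Lipschitz:
  fixes f :: "'a::metric_space \<Rightarrow> 'b::metric_space"
  assumes lip: "\<And>x y. dist (f x) (f y) \<le> s * dist x y" and s: "0 < s"
  shows "hausdorff_measure k (f ` A) \<le> ennreal (s ^ k) * hausdorff_measure k A"
  unfolding hausdorff_measure_def[of k "f ` A"]
proof (rule SUP_least)
  fix \<delta> :: real assume "\<delta> \<in> {0<..}"
  then have \<delta>: "0 < \<delta> / s" "\<delta> = s * (\<delta> / s)" using s by auto
  have "hausdorff_content k \<delta> (f ` A) \<le> ennreal (s ^ k) * hausdorff_content k (\<delta> / s) A"
    using hausdorff_content_Lipschitz[OF lip s, of k "\<delta> / s" A] \<delta>(2) by simp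
  also have "\<dots> \<le> ennreal (s ^ k) * hausdorff_measure k A"
    using \<delta>(1) by (intro mult_left_mono hausdorff_content_le_measure) auto
  finally show "hausdorff_content k \<delta> (f ` A) \<le> ennreal (s ^ k) * hausdorff_measure k A" .
qed

text \<open>The similarity and its inverse are Lipschitz with constants \<open>s\<close> and
  \<open>1 / s\<close>; each of them gives one inequality.\<close>

lemma hausdorff_measure_affine:
  fixes A :: "'a::real_normed_vector set"
  assumes s: "0 < s"
  shows "hausdorff_measure k ((\<lambda>x. s *\<^sub>R x + a) ` A) = ennreal (s ^ k) * hausdorff_measure k A"
proof (rule antisym)
  let ?f = "\<lambda>x. s *\<^sub>R x + a" and ?g = "\<lambda>x. (1 / s) *\<^sub>R (x - a)"
  show "hausdorff_measure k (?f ` A) \<le> ennreal (s ^ k) * hausdorff_measure k A"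
    using s by (intro hausdorff_measure_Lipschitz) (simp_all add: dist_norm flip: scaleR_diff_right)
  have "A = ?g ` ?f ` A"
    using s by (simp add: image_image)
  then have "hausdorff_measure k A = hausdorff_measure k (?g ` ?f ` A)"
    by simp
  also have "\<dots> \<le> ennreal ((1 / s) ^ k) * hausdorff_measure k (?f ` A)"
    using s by (intro hausdorff_measure_Lipschitz) (simp_all add: dist_norm flip: scaleR_diff_right)
  finally have "ennreal (s ^ k) * hausdorff_measure k A
      \<le> ennreal (s ^ k) * (ennreal ((1 / s) ^ k) * hausdorff_measure k (?f ` A))"
    by (rule mult_left_mono) simp
  also have "\<dots> = hausdorff_measure k (?f ` A)"
    using s by (simp add: mult.assoc[symmetric] ennreal_mult[symmetric] power_mult_distrib[symmetric] del: ennreal_power)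
  finally show "ennreal (s ^ k) * hausdorff_measure k A \<le> hausdorff_measure k (?f ` A)" .
qed

section \<open>Fibre lengths and homothetic projections\<close>

lemma nn_integral_lborel_translate:
  fixes f :: "'a::euclidean_space \<Rightarrow> ennreal"
  assumes "f \<in> borel_measurable borel"
  shows "(\<integral>\<^sup>+x. f (x + a) \<partial>lborel) = (\<integral>\<^sup>+x. f x \<partial>lborel)"
proof -
  have "(\<integral>\<^sup>+x. f x \<partial>lborel) = (\<integral>\<^sup>+x. f x \<partial>distr lborel borel ((+) a))"
    by (simp add: lborel_distr_plus)
  also have "\<dots> = (\<integral>\<^sup>+x. f (x + a) \<partial>lborel)"
    using assms by (subst nn_integral_distr) (auto simp: add.commute)
  finally show ?thesis ..
qed

lemma nn_integral_lborel_affine: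
  fixes f :: "'a::euclidean_space \<Rightarrow> ennreal"
  assumes [measurable]: "f \<in> borel_measurable borel" and c: "0 < c"
  shows "(\<integral>\<^sup>+x. f x \<partial>lborel) = ennreal (c ^ DIM('a)) * (\<integral>\<^sup>+x. f (c *\<^sub>R x + a) \<partial>lborel)"
  using c by (subst lborel_affine[of c a])
     (simp_all add: nn_integral_density nn_integral_distr nn_integral_cmult add.commute)

text \<open>By Tonelli the integral over \<open>t\<close> can be taken outermost; for fixed
  \<open>t\<close>, translation invariance moves the shift from \<open>\<phi>\<close> to the slab.
  Each point then lies in the shifted slab for a set of \<open>t\<close> of length \<open>h\<close>.
  The slab stands in for the hyperplane orthogonal to \<open>u\<close>, which carries no measure of
  its own here.\<close>

lemma nn_integral_slab:
  fixes u :: "'a::euclidean_space" and \<phi> :: "'a \<Rightarrow> ennreal"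
  assumes u: "norm u = 1" and h: "0 \<le> h" and [measurable]: "\<phi> \<in> borel_measurable borel"
  shows "(\<integral>\<^sup>+x. indicator {0..h} (u \<bullet> x) * (\<integral>\<^sup>+t. \<phi> (x + t *\<^sub>R u) \<partial>lborel) \<partial>lborel)
    = ennreal h * (\<integral>\<^sup>+x. \<phi> x \<partial>lborel)"
proof -
  have uu: "u \<bullet> u = 1"
    using u by (simp add: dot_square_norm)
  have "(\<integral>\<^sup>+x. indicator {0..h} (u \<bullet> x) * (\<integral>\<^sup>+t. \<phi> (x + t *\<^sub>R u) \<partial>lborel) \<partial>lborel)
     = (\<integral>\<^sup>+x. (\<integral>\<^sup>+t. indicator {0..h} (u \<bullet> x) * \<phi> (x + t *\<^sub>R u) \<partial>lborel) \<partial>lborel)"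
    by (simp add: nn_integral_cmult)
  also have "\<dots> = (\<integral>\<^sup>+t. (\<integral>\<^sup>+x. indicator {0..h} (u \<bullet> x) * \<phi> (x + t *\<^sub>R u) \<partial>lborel) \<partial>lborel)"
    by (rule lborel_pair.Fubini'[symmetric]) measurable
  also have "\<dots> = (\<integral>\<^sup>+t. (\<integral>\<^sup>+x. indicator {0..h} (u \<bullet> x - t) * \<phi> x \<partial>lborel) \<partial>lborel)"
  proof (rule nn_integral_cong)
    fix t :: real
    show "(\<integral>\<^sup>+x. indicator {0..h} (u \<bullet> x) * \<phi> (x + t *\<^sub>R u) \<partial>lborel)
      = (\<integral>\<^sup>+x. indicator {0..h} (u \<bullet> x - t) * \<phi> x \<partial>lborel)"
      using nn_integral_lborel_translate[of "\<lambda>x. indicator {0..h} (u \<bullet> x - t) * \<phi> x" "t *\<^sub>R u"]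
      by (simp add: inner_add_right uu)
  qed
  also have "\<dots> = (\<integral>\<^sup>+x. (\<integral>\<^sup>+t. indicator {0..h} (u \<bullet> x - t) * \<phi> x \<partial>lborel) \<partial>lborel)"
    by (rule lborel_pair.Fubini') measurable
  also have "\<dots> = (\<integral>\<^sup>+x. ennreal h * \<phi> x \<partial>lborel)"
  proof (rule nn_integral_cong)
    fix x
    have "(\<integral>\<^sup>+t. indicator {0..h} (u \<bullet> x - t) * \<phi> x \<partial>lborel)
      = (\<integral>\<^sup>+t. indicator {u \<bullet> x - h..u \<bullet> x} t * \<phi> x \<partial>lborel)"
      by (intro nn_integral_cong) (auto simp: indicator_def)
    also have "\<dots> = ennreal h * \<phi> x"
      using h by (subst nn_integral_multc) auto
    finally show "(\<integral>\<^sup>+t. indicator {0..h} (u \<bullet> x - t) * \<phi> x \<partial>lborel) = ennreal h * \<phi> x" .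
  qed
  also have "\<dots> = ennreal h * (\<integral>\<^sup>+x. \<phi> x \<partial>lborel)"
    by (rule nn_integral_cmult) simp
  finally show ?thesis .
qed

text \<open>A function on the whole space that is constant along \<open>u\<close>, hence depends on
  \<open>x\<close> only through its projection; integrating it over a slab of thickness 1 acts as
  integration over \<open>perp_space u\<close>.\<close>

definition fibre_length :: "'a::euclidean_space \<Rightarrow> 'a set \<Rightarrow> 'a \<Rightarrow> ennreal" where
  "fibre_length u A x = (\<integral>\<^sup>+t. indicator A (x + t *\<^sub>R u) \<partial>lborel)"

lemma fibre_length_measurable:
  fixes A :: "'a::euclidean_space set"
  assumes [measurable]: "A \<in> sets borel"
  shows "fibre_length u A \<in> borel_measurable borel"
proof -
  have "(\<lambda>x. \<integral>\<^sup>+t. indicator A (x + t *\<^sub>R u) \<partial>lborel) \<in> borel_measurable borel"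
    by (rule lborel.borel_measurable_nn_integral) measurable
  then show ?thesis
    unfolding fibre_length_def by simp
qed

lemma fibre_length_eq_emeasure:
  fixes A :: "'a::euclidean_space set"
  assumes "closed A"
  shows "closed {t. x + t *\<^sub>R u \<in> A}"
    "fibre_length u A x = emeasure lborel {t. x + t *\<^sub>R u \<in> A}"
proof -
  have "closed ((\<lambda>t. x + t *\<^sub>R u) -` A)"
    by (intro continuous_closed_vimage assms continuous_intros)
  then show cl: "closed {t. x + t *\<^sub>R u \<in> A}"
    by (simp add: vimage_def)
  have "fibre_length u A x = (\<integral>\<^sup>+t. indicator {t. x + t *\<^sub>R u \<in> A} t \<partial>lborel)"
    unfolding fibre_length_def by (simp add: indicator_def)
  also have "\<dots> = emeasure lborel {t. x + t *\<^sub>R u \<in> A}"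
    using borel_closed[OF cl] by simp
  finally show "fibre_length u A x = emeasure lborel {t. x + t *\<^sub>R u \<in> A}" .
qed

text \<open>The substitution of \<open>s *\<^sub>R x + a\<close> has Jacobian
  \<open>s ^ DIM('a)\<close> and turns the slab into one of thickness \<open>s\<close>, because
  \<open>a\<close> is orthogonal to \<open>u\<close>. The thickness cancels one factor
  \<open>s\<close>; the remaining ones scale the base.\<close>

lemma nn_integral_fibre_length:
  fixes A :: "'a::euclidean_space set"
  assumes A[measurable]: "A \<in> sets borel" and u: "norm u = 1" and a: "u \<bullet> a = 0" and s: "0 < s"
  shows "(\<integral>\<^sup>+x. indicator {0..1} (u \<bullet> x) * fibre_length u A (s *\<^sub>R x + a) \<partial>lborel)
    = emeasure lborel A / ennreal (s ^ (DIM('a) - 1))"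
proof -
  note fibre_length_measurable[measurable]
  have pow: "s ^ DIM('a) = s * s ^ (DIM('a) - 1)"
    by (simp add: power_eq_if)
  let ?I = "\<integral>\<^sup>+x. indicator {0..1} (u \<bullet> x) * fibre_length u A (s *\<^sub>R x + a) \<partial>lborel"
  have ind: "indicator {0..1} (u \<bullet> x) = (indicator {0..s} (u \<bullet> (s *\<^sub>R x + a)) :: ennreal)" for x
    using s a by (auto simp: indicator_def inner_add_right zero_le_mult_iff)
  have "ennreal s * emeasure lborel A
     = (\<integral>\<^sup>+y. indicator {0..s} (u \<bullet> y) * fibre_length u A y \<partial>lborel)"
    unfolding fibre_length_def using s by (subst nn_integral_slab) (auto simp: u)
  also have "\<dots> = ennreal (s ^ DIM('a)) * ?I"
    unfolding ind by (rule nn_integral_lborel_affine) (use s in measurable)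
  also have "\<dots> = ennreal s * (ennreal (s ^ (DIM('a) - 1)) * ?I)"
    unfolding pow using s by (simp add: ennreal_mult mult.assoc del: ennreal_power)
  finally have "emeasure lborel A = ennreal (s ^ (DIM('a) - 1)) * ?I"
    using s by (simp add: ennreal_mult_cancel_left)
  then show ?thesis
    using s by (simp add: mult_divide_eq_ennreal mult.commute[of "ennreal _"] del: ennreal_power)
qed

text \<open>The one-dimensional Brunn-Minkowski inequality. Nonemptiness of both sets is essential:
  if one is empty, no sum is forced into \<open>W\<close>, while the other may have positive
  length.\<close>

lemma emeasure_interval_sum_ge:
  fixes I J :: "real set"
  assumes I: "compact I" "convex I" "I \<noteq> {}" and J: "compact J" "convex J" "J \<noteq> {}"
    and W: "W \<in> sets borel" "\<And>s t. s \<in> I \<Longrightarrow> t \<in> J \<Longrightarrow> s + t \<in> W"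
  shows "emeasure lborel I + emeasure lborel J \<le> emeasure lborel W"
proof -
  obtain p q where pq: "I = {p..q}"
    using I connected_compact_interval_1 connected_convex_1 by metis
  obtain r v where rv: "J = {r..v}"
    using J connected_compact_interval_1 connected_convex_1 by metis
  have le: "p \<le> q" "r \<le> v"
    using I(3) J(3) pq rv by auto
  have "{p + r..q + v} \<subseteq> W"
  proof
    fix x assume x: "x \<in> {p + r..q + v}"
    \<comment> \<open>The least point of \<open>I\<close> whose partner \<open>x - s\<close> does
      not exceed the upper end of \<open>J\<close>.\<close>
    define s where "s = max p (x - v)"
    have "s \<in> I" "x - s \<in> J"
      using x le by (auto simp: s_def pq rv)
    then show "x \<in> W"
      using W(2)[of s "x - s"] by simp
  qed
  then have "emeasure lborel {p + r..q + v} \<le> emeasure lborel W"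
    using W(1) by (intro emeasure_mono) auto
  moreover have "emeasure lborel I + emeasure lborel J = emeasure lborel {p + r..q + v}"
    using le by (simp add: pq rv flip: ennreal_plus)
  ultimately show ?thesis by simp
qed

lemma compact_set_plus:
  fixes A B :: "'a::real_normed_vector set"
  assumes "compact A" "compact B"
  shows "compact (A + B)"
proof -
  have "A + B = (\<Union>x\<in>A. \<Union>y\<in>B. {x + y})"
    by (auto simp: set_plus_def)
  then show ?thesis
    using compact_sums'[OF assms] by simp
qed

text \<open>Chords are compact intervals, so their lengths add up as in dimension one. The
  hypothesis \<open>iff\<close> excludes an empty chord opposite a chord of positive length, for
  which the estimate could fail; this is the point at which homothety of the projections
  enters.\<close>

lemma fibre_length_add_le:
  fixes K L :: "'a::euclidean_space set"
  assumes K: "compact K" "convex K" and L: "compact L" "convex L" and u: "norm u = 1"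
    and iff: "(\<exists>t. x + t *\<^sub>R u \<in> K) \<longleftrightarrow> (\<exists>t. y + t *\<^sub>R u \<in> L)"
  shows "fibre_length u K x + fibre_length u L y \<le> fibre_length u (K + L) (x + y)"
proof -
  have KL: "compact (K + L)"
    by (rule compact_set_plus[OF K(1) L(1)])
  have fib: "compact {t. x + t *\<^sub>R u \<in> A} \<and> convex {t. x + t *\<^sub>R u \<in> A}"
    if A: "compact A" "convex A" for A :: "'a set" and x
  proof
    have "bounded {t. x + t *\<^sub>R u \<in> A}"
    proof -
      obtain b where b: "\<And>a. a \<in> A \<Longrightarrow> norm a \<le> b"
        using compact_imp_bounded[OF A(1)] unfolding bounded_iff by blast
      have "norm t \<le> b + norm x" if "x + t *\<^sub>R u \<in> A" for t
        using b[OF that] norm_triangle_ineq2[of "t *\<^sub>R u" "- x"] u by (simp add: add.commute)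
      then show ?thesis
        unfolding bounded_iff by auto
    qed
    then show "compact {t. x + t *\<^sub>R u \<in> A}"
      using fibre_length_eq_emeasure(1)[OF compact_imp_closed[OF A(1)]]
      by (simp add: compact_eq_bounded_closed)
    have "x + (a * s + b * t) *\<^sub>R u = a *\<^sub>R (x + s *\<^sub>R u) + b *\<^sub>R (x + t *\<^sub>R u)" if "a + b = 1" for a b s t
    proof -
      have "a *\<^sub>R (x + s *\<^sub>R u) + b *\<^sub>R (x + t *\<^sub>R u) = (a + b) *\<^sub>R x + (a * s + b * t) *\<^sub>R u"
        by (simp add: algebra_simps)
      then show ?thesis using that by simp
    qed
    then show "convex {t. x + t *\<^sub>R u \<in> A}"
      using A(2) unfolding convex_def by simp
  qed
  show ?thesis
  proof (cases "\<exists>t. x + t *\<^sub>R u \<in> K")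
    case True
    have "s + t \<in> {t. (x + y) + t *\<^sub>R u \<in> K + L}" if "x + s *\<^sub>R u \<in> K" "y + t *\<^sub>R u \<in> L" for s t
      using set_plus_intro[OF that] by (simp add: scaleR_add_left add_ac)
    then show ?thesis
      unfolding fibre_length_eq_emeasure(2)[OF compact_imp_closed[OF K(1)]]
        fibre_length_eq_emeasure(2)[OF compact_imp_closed[OF L(1)]]
        fibre_length_eq_emeasure(2)[OF compact_imp_closed[OF KL]]
      using True iff fib[OF K] fib[OF L] borel_closed[OF fibre_length_eq_emeasure(1)[OF compact_imp_closed[OF KL]]]
      by (intro emeasure_interval_sum_ge) auto
  next
    case False
    then have "fibre_length u K x = 0" "fibre_length u L y = 0"
      using iff by (auto simp: fibre_length_def)
    then show ?thesis by simp
  qed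
qed

text \<open>The divisors are Jacobians: while \<open>x\<close> runs through the slab, chords of
  \<open>K\<close> and \<open>L\<close> are taken over points that move with the factors
  \<open>c / (1 + c)\<close> and \<open>1 / (1 + c)\<close>, so the two integrals are rescaled
  volumes.\<close>

lemma emeasure_sum_homothetic_projections:
  fixes K L :: "'a::euclidean_space set"
  assumes K: "compact K" "convex K" and L: "compact L" "convex L" "L \<noteq> {}" and u: "norm u = 1"
    and c: "0 < c" and hom: "perp_proj u ` K = (\<lambda>x. c *\<^sub>R x + a) ` perp_proj u ` L"
  shows "emeasure lborel K / ennreal ((c / (1 + c)) ^ (DIM('a) - 1))
       + emeasure lborel L / ennreal ((1 / (1 + c)) ^ (DIM('a) - 1)) \<le> emeasure lborel (K + L)"
proof -
  have uu: "u \<bullet> u = 1"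
    using u by (simp add: dot_square_norm)
  have perp: "u \<bullet> perp_proj u x = 0" for x
    by (simp add: perp_proj_unit[OF u] inner_diff_right uu)
  obtain l where "l \<in> L" using L by auto
  then have "c *\<^sub>R perp_proj u l + a \<in> perp_proj u ` K"
    unfolding hom by blast
  then obtain k where "perp_proj u k = c *\<^sub>R perp_proj u l + a"
    by auto
  \<comment> \<open>\<open>a\<close> is a combination of projected points, hence orthogonal to
    \<open>u\<close>; otherwise the substitution would displace the slab.\<close>
  then have a: "u \<bullet> a = 0"
    using perp[of k] perp[of l] by (simp add: inner_add_right)
  have fib_iff: "(\<exists>t. x + t *\<^sub>R u \<in> A) \<longleftrightarrow> perp_proj u x \<in> perp_proj u ` A" for x and A :: "'a set"
  proof
    assume "\<exists>t. x + t *\<^sub>R u \<in> A"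
    then obtain t where "x + t *\<^sub>R u \<in> A" ..
    moreover have "perp_proj u (x + t *\<^sub>R u) = perp_proj u x"
      by (simp add: perp_proj_unit[OF u] inner_add_right uu algebra_simps)
    ultimately show "perp_proj u x \<in> perp_proj u ` A"
      by (metis imageI)
  next
    assume "perp_proj u x \<in> perp_proj u ` A"
    then obtain y where y: "y \<in> A" "x - (u \<bullet> x) *\<^sub>R u = y - (u \<bullet> y) *\<^sub>R u"
      by (auto simp: perp_proj_unit[OF u])
    then have "x + (u \<bullet> y - u \<bullet> x) *\<^sub>R u = y"
      by (simp add: algebra_simps)
    then show "\<exists>t. x + t *\<^sub>R u \<in> A"
      using y(1) by metis
  qed
  \<comment> \<open>The unique solution of \<open>?x + ?y = x\<close> and
    \<open>?x = c ?y + a\<close>: the lines through \<open>?x\<close> and \<open>?y\<close>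
    correspond under the homothety, and their sum is the line through \<open>x\<close>.\<close>
  let ?x = "\<lambda>x. (c / (1 + c)) *\<^sub>R x + (1 / (1 + c)) *\<^sub>R a"
    and ?y = "\<lambda>x. (1 / (1 + c)) *\<^sub>R x + (- 1 / (1 + c)) *\<^sub>R a"
  have xy: "?x x = c *\<^sub>R ?y x + a" "?x x + ?y x = x" for x
  proof -
    have "c *\<^sub>R ?y x + a = (c / (1 + c)) *\<^sub>R x + (1 - c / (1 + c)) *\<^sub>R a"
      by (simp add: algebra_simps)
    moreover have "1 - c / (1 + c) = 1 / (1 + c)"
      using c by (simp add: field_simps)
    ultimately show "?x x = c *\<^sub>R ?y x + a" by simp
    have "?x x + ?y x = (c / (1 + c) + 1 / (1 + c)) *\<^sub>R x"
      by (simp add: algebra_simps)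
    moreover have "c / (1 + c) + 1 / (1 + c) = 1"
      using c by (simp add: field_simps)
    ultimately show "?x x + ?y x = x" by simp
  qed
  have iff: "(\<exists>t. ?x x + t *\<^sub>R u \<in> K) \<longleftrightarrow> (\<exists>t. ?y x + t *\<^sub>R u \<in> L)" for x
  proof -
    have "perp_proj u (?x x) = c *\<^sub>R perp_proj u (?y x) + a"
      unfolding xy(1) perp_proj_unit[OF u] using a by (simp add: inner_add_right algebra_simps)
    then have "perp_proj u (?x x) \<in> perp_proj u ` K \<longleftrightarrow> perp_proj u (?y x) \<in> perp_proj u ` L"
      unfolding hom using c by (auto simp: image_iff)
    then show ?thesis
      unfolding fib_iff .
  qed
  have borel: "K \<in> sets borel" "L \<in> sets borel" "K + L \<in> sets borel"
    using compact_set_plus[OF K(1) L(1)] K L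
    by (auto intro!: borel_closed compact_imp_closed)
  note [measurable] = fibre_length_measurable[OF borel(1)] fibre_length_measurable[OF borel(2)]
  have "emeasure lborel K / ennreal ((c / (1 + c)) ^ (DIM('a) - 1))
       + emeasure lborel L / ennreal ((1 / (1 + c)) ^ (DIM('a) - 1))
     = (\<integral>\<^sup>+x. indicator {0..1} (u \<bullet> x) * fibre_length u K (?x x) \<partial>lborel)
     + (\<integral>\<^sup>+x. indicator {0..1} (u \<bullet> x) * fibre_length u L (?y x) \<partial>lborel)"
    using a c by (subst (1 2) nn_integral_fibre_length[OF _ u]) (auto simp: borel)
  also have "\<dots> = (\<integral>\<^sup>+x. indicator {0..1} (u \<bullet> x) * fibre_length u K (?x x)
      + indicator {0..1} (u \<bullet> x) * fibre_length u L (?y x) \<partial>lborel)"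
    by (rule nn_integral_add[symmetric]) measurable
  also have "\<dots> \<le> (\<integral>\<^sup>+x. indicator {0..1} (u \<bullet> x) * fibre_length u (K + L) (1 *\<^sub>R x + 0) \<partial>lborel)"
  proof (rule nn_integral_mono)
    fix x
    have "fibre_length u K (?x x) + fibre_length u L (?y x) \<le> fibre_length u (K + L) (?x x + ?y x)"
      by (rule fibre_length_add_le[OF K L(1,2) u iff])
    then show "indicator {0..1} (u \<bullet> x) * fibre_length u K (?x x)
      + indicator {0..1} (u \<bullet> x) * fibre_length u L (?y x)
      \<le> indicator {0..1} (u \<bullet> x) * fibre_length u (K + L) (1 *\<^sub>R x + 0)"
      unfolding xy(2) by (simp add: mult_left_mono flip: distrib_left)
  qed
  also have "\<dots> = emeasure lborel (K + L)"
    using nn_integral_fibre_length[OF borel(3) u, of 0 1] by (simp add: divide_ennreal_def)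
  finally show ?thesis .
qed

section \<open>Hausdorff measure of coordinate cubes\<close>

text \<open>The finite cover is continued by empty sets, which are free because
  \<open>hausdorff_gauge\<close> assigns them 0 even for \<open>k = 0\<close>;
  \<open>0 \<le> \<delta>\<close> admits them at every scale.\<close>

lemma hausdorff_content_finite_cover:
  fixes U :: "'i \<Rightarrow> 'a::metric_space set"
  assumes I: "finite I" and A: "A \<subseteq> (\<Union>i\<in>I. U i)" and \<delta>: "0 \<le> \<delta>"
    and U: "\<And>i. i \<in> I \<Longrightarrow> bounded (U i)" "\<And>i. i \<in> I \<Longrightarrow> diameter (U i) \<le> \<delta>"
  shows "hausdorff_content k \<delta> A \<le> (\<Sum>i\<in>I. hausdorff_gauge k (U i))"
proof -
  obtain h where h: "bij_betw h {0..<card I} I"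
    using ex_bij_betw_nat_finite[OF I] by blast
  have hI: "h n \<in> I" if "n < card I" for n
    using h that by (auto simp: bij_betw_def)
  let ?V = "\<lambda>n. if n < card I then U (h n) else {}"
  have "hausdorff_content k \<delta> A \<le> (\<Sum>n. hausdorff_gauge k (?V n))"
  proof (rule hausdorff_content_le)
    show "A \<subseteq> (\<Union>n. ?V n)"
    proof
      fix x assume "x \<in> A"
      then obtain i where "i \<in> I" "x \<in> U i" using A by auto
      then obtain n where "n < card I" "i = h n"
        using h unfolding bij_betw_def by force
      then show "x \<in> (\<Union>n. ?V n)"
        using \<open>x \<in> U i\<close> by (intro UN_I[of n]) auto
    qed
  qed (use U hI \<delta> in auto)
  also have "\<dots> = (\<Sum>n\<in>{0..<card I}. hausdorff_gauge k (?V n))"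
    by (rule suminf_finite) (auto simp: hausdorff_gauge_def)
  also have "\<dots> = (\<Sum>n\<in>{0..<card I}. hausdorff_gauge k (U (h n)))"
    by (rule sum.cong) auto
  also have "\<dots> = (\<Sum>i\<in>I. hausdorff_gauge k (U i))"
    by (rule sum.reindex_bij_betw[OF h])
  finally show ?thesis .
qed

section \<open>Projections, cubes and prisms for a coordinate subspace\<close>

definition coord_proj :: "'a::euclidean_space set \<Rightarrow> 'a \<Rightarrow> 'a" where
  "coord_proj B x = (\<Sum>b\<in>B. (x \<bullet> b) *\<^sub>R b)"

definition coord_cube :: "'a::euclidean_space set \<Rightarrow> 'a \<Rightarrow> real \<Rightarrow> 'a set" where
  "coord_cube B a s = {y. (\<forall>b\<in>B. y \<bullet> b \<in> {a \<bullet> b..a \<bullet> b + s}) \<and> (\<forall>b\<in>Basis - B. y \<bullet> b = 0)}"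

text \<open>Thickening by the unit cube of the complementary coordinates. For \<open>S\<close> in
  the span of \<open>B\<close>, the ambient volume of the prism serves as the
  \<open>card B\<close>-dimensional Lebesgue measure of \<open>S\<close>, so the subspace gets no
  type of its own.\<close>

definition prism :: "'a::euclidean_space set \<Rightarrow> 'a set \<Rightarrow> 'a set" where
  "prism B S = {x. coord_proj B x \<in> S \<and> (\<forall>b\<in>Basis - B. x \<bullet> b \<in> {0..1})}"

context
  fixes B :: "'a::euclidean_space set"
  assumes B: "B \<subseteq> Basis"
begin

lemma finite_subset_Basis: "finite B"
  using B finite_Basis by (rule finite_subset)

lemma coord_proj_inner: "b \<in> Basis \<Longrightarrow> coord_proj B x \<bullet> b = (if b \<in> B then x \<bullet> b else 0)"
proof -
  assume b: "b \<in> Basis"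
  have "coord_proj B x \<bullet> b = (\<Sum>c\<in>B. if c = b then x \<bullet> b else 0)"
    unfolding coord_proj_def inner_sum_left using B b
    by (intro sum.cong) (auto simp: inner_Basis)
  then show ?thesis
    using finite_subset_Basis by simp
qed

lemma subset_BasisD: "b \<in> B \<Longrightarrow> b \<in> Basis"
  using B by blast

lemma coord_proj_eqI:
  assumes "\<And>b. b \<in> B \<Longrightarrow> x \<bullet> b = y \<bullet> b" "\<And>b. b \<in> Basis - B \<Longrightarrow> y \<bullet> b = 0"
  shows "coord_proj B x = y"
proof (rule euclidean_eqI)
  fix b :: 'a assume "b \<in> Basis"
  then show "coord_proj B x \<bullet> b = y \<bullet> b"
    using assms[of b] by (cases "b \<in> B") (simp_all add: coord_proj_inner)
qed

lemma coord_proj_in_coord_cube: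
  "coord_proj B x \<in> coord_cube B a s \<longleftrightarrow> (\<forall>b\<in>B. x \<bullet> b \<in> {a \<bullet> b..a \<bullet> b + s})"
  by (simp add: coord_cube_def coord_proj_inner subset_BasisD)

lemma continuous_coord_proj: "continuous_on S (coord_proj B)"
  unfolding coord_proj_def by (intro continuous_intros)

lemma coord_cube_affine:
  assumes s: "0 < s"
  shows "coord_cube B a s = (\<lambda>x. s *\<^sub>R x + coord_proj B a) ` coord_cube B 0 1"
proof
  show "coord_cube B a s \<subseteq> (\<lambda>x. s *\<^sub>R x + coord_proj B a) ` coord_cube B 0 1"
  proof
    fix y assume y: "y \<in> coord_cube B a s"
    let ?x = "(1 / s) *\<^sub>R (y - coord_proj B a)"
    have "?x \<bullet> b \<in> {0..1}" if "b \<in> B" for b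
    proof -
      have "?x \<bullet> b = (y \<bullet> b - a \<bullet> b) / s"
        using that by (simp add: inner_diff_left coord_proj_inner subset_BasisD)
      moreover have "y \<bullet> b \<in> {a \<bullet> b..a \<bullet> b + s}"
        using y that by (simp add: coord_cube_def)
      ultimately show ?thesis
        using s by simp
    qed
    moreover have "?x \<bullet> b = 0" if "b \<in> Basis - B" for b
      using y that by (simp add: coord_cube_def inner_diff_left coord_proj_inner)
    ultimately have "?x \<in> coord_cube B 0 1"
      by (simp add: coord_cube_def)
    moreover have "y = s *\<^sub>R ?x + coord_proj B a"
      using s by simp
    ultimately show "y \<in> (\<lambda>x. s *\<^sub>R x + coord_proj B a) ` coord_cube B 0 1"
      by blast
  qed
  show "(\<lambda>x. s *\<^sub>R x + coord_proj B a) ` coord_cube B 0 1 \<subseteq> coord_cube B a s"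
  proof (rule image_subsetI)
    fix x :: 'a assume x: "x \<in> coord_cube B 0 1"
    have "(s *\<^sub>R x + coord_proj B a) \<bullet> b \<in> {a \<bullet> b..a \<bullet> b + s}" if "b \<in> B" for b
    proof -
      have "(s *\<^sub>R x + coord_proj B a) \<bullet> b = s * (x \<bullet> b) + a \<bullet> b"
        using that by (simp add: inner_add_left coord_proj_inner subset_BasisD)
      moreover have "x \<bullet> b \<in> {0..1}"
        using x that by (simp add: coord_cube_def)
      ultimately show ?thesis
        using s by (simp add: mult_left_le)
    qed
    moreover have "(s *\<^sub>R x + coord_proj B a) \<bullet> b = 0" if "b \<in> Basis - B" for b
      using x that by (simp add: coord_cube_def inner_add_left coord_proj_inner)
    ultimately show "s *\<^sub>R x + coord_proj B a \<in> coord_cube B a s"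
      by (simp add: coord_cube_def)
  qed
qed

lemma hausdorff_measure_coord_cube:
  "0 < s \<Longrightarrow> hausdorff_measure k (coord_cube B a s) = ennreal (s ^ k) * hausdorff_measure k (coord_cube B 0 1)"
  unfolding coord_cube_affine[of s a] by (rule hausdorff_measure_affine)

lemma emeasure_cbox_coord:
  fixes p q :: 'a and s :: real
  assumes "\<And>b. b \<in> B \<Longrightarrow> q \<bullet> b - p \<bullet> b = s" "\<And>b. b \<in> Basis - B \<Longrightarrow> q \<bullet> b - p \<bullet> b = r" "0 \<le> s" "0 \<le> r"
  shows "emeasure lborel (cbox p q) = ennreal (s ^ card B * r ^ card (Basis - B))"
proof -
  have "p \<bullet> b \<le> q \<bullet> b" if "b \<in> Basis" for b
    using assms(1)[of b] assms(2)[of b] assms(3,4) that by (cases "b \<in> B") auto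
  then have "emeasure lborel (cbox p q) = ennreal (\<Prod>b\<in>Basis. (q - p) \<bullet> b)"
    by (rule emeasure_lborel_cbox)
  also have "(\<Prod>b\<in>Basis. (q - p) \<bullet> b) = (\<Prod>b\<in>Basis - B. (q - p) \<bullet> b) * (\<Prod>b\<in>B. (q - p) \<bullet> b)"
    by (rule prod.subset_diff[OF B finite_Basis])
  also have "\<dots> = s ^ card B * r ^ card (Basis - B)"
    using assms by (simp add: inner_diff_left)
  finally show ?thesis .
qed

lemma diameter_coord_cube:
  assumes "0 \<le> s" shows "bounded (coord_cube B a s)" "diameter (coord_cube B a s) \<le> real (card B) * s"
proof -
  have *: "norm (x - y) \<le> real (card B) * s" if "x \<in> coord_cube B a s" "y \<in> coord_cube B a s" for x y
  proof -
    have "norm (x - y) \<le> (\<Sum>b\<in>Basis. \<bar>(x - y) \<bullet> b\<bar>)"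
      by (rule norm_le_l1)
    also have "\<dots> = (\<Sum>b\<in>B. \<bar>(x - y) \<bullet> b\<bar>)"
      using that B by (intro sum.mono_neutral_right) (auto simp: coord_cube_def inner_diff_left)
    also have "\<dots> \<le> (\<Sum>b\<in>B. s)"
    proof (rule sum_mono)
      fix b assume "b \<in> B"
      then have "x \<bullet> b \<in> {a \<bullet> b..a \<bullet> b + s}" "y \<bullet> b \<in> {a \<bullet> b..a \<bullet> b + s}"
        using that by (auto simp: coord_cube_def)
      then show "\<bar>(x - y) \<bullet> b\<bar> \<le> s"
        by (auto simp: inner_diff_left abs_le_iff)
    qed
    finally show ?thesis by simp
  qed
  show "bounded (coord_cube B a s)"
    unfolding bounded_two_points using * by (auto simp: dist_norm)
  show "diameter (coord_cube B a s) \<le> real (card B) * s"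
    using * assms by (intro diameter_le) auto
qed

text \<open>Of the \<open>N ^ k\<close> subcubes of side \<open>1 / N\<close>, each has diameter at
  most \<open>k / N\<close>. This crude bound already scales correctly, so the total charge is at
  most \<open>?C\<close> whatever \<open>N\<close> is.\<close>

lemma hausdorff_measure_unit_cube_finite: "hausdorff_measure (card B) (coord_cube B 0 1) < top"
proof -
  let ?k = "card B"
  let ?C = "unit_ball_vol (real ?k) * (real ?k / 2) ^ ?k"
  have "hausdorff_content ?k \<delta> (coord_cube B 0 1) \<le> ennreal ?C" if \<delta>: "0 < \<delta>" for \<delta>
  proof -
    obtain N0 :: nat where N0: "real ?k / \<delta> < real N0"
      using reals_Archimedean2 by blast
    define N where "N = Suc N0"
    have N: "0 < N" "real ?k / real N \<le> \<delta>"
    proof -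
      have "real ?k < real N0 * \<delta>"
        using N0 \<delta> by (simp add: field_simps)
      also have "\<dots> \<le> real N * \<delta>"
        using \<delta> by (simp add: N_def)
      finally show "real ?k / real N \<le> \<delta>"
        by (simp add: N_def field_simps)
    qed (simp add: N_def)
    define I where "I = (\<Pi>\<^sub>E b\<in>B. {..<N})"
    define Q where "Q f = coord_cube B (\<Sum>b\<in>B. (real (f b) / real N) *\<^sub>R b) (1 / real N)" for f
    have I: "finite I" "card I = N ^ ?k"
      by (simp_all add: I_def finite_PiE finite_subset_Basis card_PiE)
    have corner: "(\<Sum>c\<in>B. (real (f c) / real N) *\<^sub>R c) \<bullet> b = real (f b) / real N" if "b \<in> B" for f b
    proof -
      have "(\<Sum>c\<in>B. (real (f c) / real N) *\<^sub>R c) \<bullet> b = (\<Sum>c\<in>B. if c = b then real (f b) / real N else 0)"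
        unfolding inner_sum_left using B that
        by (intro sum.cong) (auto simp: inner_not_same_Basis subset_iff)
      then show ?thesis using finite_subset_Basis that by simp
    qed
    have cover: "coord_cube B 0 1 \<subseteq> (\<Union>f\<in>I. Q f)"
    proof
      fix x :: 'a assume x: "x \<in> coord_cube B 0 1"
      \<comment> \<open>Rounding down would send the coordinate value 1 to the index
        \<open>N\<close>; \<open>min (N - 1)\<close> puts it into the last subcube.\<close>
      define f where "f = (\<lambda>b\<in>B. min (N - 1) (nat \<lfloor>x \<bullet> b * real N\<rfloor>))"
      have "f \<in> I"
        using N by (auto simp: I_def f_def)
      moreover have "x \<bullet> b \<in> {real (f b) / real N..real (f b) / real N + 1 / real N}" if b: "b \<in> B" for b
      proof -
        have xb: "0 \<le> x \<bullet> b" "x \<bullet> b \<le> 1"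
          using x b by (auto simp: coord_cube_def)
        have fl: "real (nat \<lfloor>x \<bullet> b * real N\<rfloor>) \<le> x \<bullet> b * real N" "x \<bullet> b * real N < real (nat \<lfloor>x \<bullet> b * real N\<rfloor>) + 1"
          using xb by (auto simp: of_nat_nat)
        have up: "x \<bullet> b * real N \<le> real N"
          using xb by (simp add: mult_left_le_one_le)
        have "real (f b) \<le> x \<bullet> b * real N \<and> x \<bullet> b * real N \<le> real (f b) + 1"
        proof (cases "nat \<lfloor>x \<bullet> b * real N\<rfloor> \<le> N - 1")
          case True
          then have "f b = nat \<lfloor>x \<bullet> b * real N\<rfloor>" using b by (simp add: f_def)
          then show ?thesis using fl by simp
        next
          case False
          then have "f b = N - 1" using b by (simp add: f_def)
          then show ?thesis using fl up False N(1) by (simp add: of_nat_diff)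
        qed
        then show ?thesis
          using N(1) by (simp add: field_simps)
      qed
      ultimately show "x \<in> (\<Union>f\<in>I. Q f)"
        using x corner by (intro UN_I[of f]) (auto simp: Q_def coord_cube_def)
    qed
    have gauge: "hausdorff_gauge ?k (Q f) \<le> ennreal (unit_ball_vol (real ?k) * (real ?k / (2 * real N)) ^ ?k)" for f
    proof -
      have "(diameter (Q f) / 2) ^ ?k \<le> (real ?k / (2 * real N)) ^ ?k"
        using diameter_coord_cube[of "1 / real N" "\<Sum>b\<in>B. (real (f b) / real N) *\<^sub>R b"]
          diameter_ge_0[of "Q f"]
        by (intro power_mono) (auto simp: Q_def)
      then show ?thesis
        by (auto simp: hausdorff_gauge_def intro!: ennreal_leI mult_left_mono)
    qed
    have "hausdorff_content ?k \<delta> (coord_cube B 0 1) \<le> (\<Sum>f\<in>I. hausdorff_gauge ?k (Q f))"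
    proof (rule hausdorff_content_finite_cover[OF I(1) cover])
      show "bounded (Q f)" "diameter (Q f) \<le> \<delta>" for f
        using diameter_coord_cube[of "1 / real N" "\<Sum>b\<in>B. (real (f b) / real N) *\<^sub>R b"] N
        by (auto simp: Q_def)
    qed (use \<delta> in auto)
    also have "\<dots> \<le> (\<Sum>f\<in>I. ennreal (unit_ball_vol (real ?k) * (real ?k / (2 * real N)) ^ ?k))"
      by (intro sum_mono gauge)
    also have "\<dots> = ennreal (real (N ^ ?k) * (unit_ball_vol (real ?k) * (real ?k / (2 * real N)) ^ ?k))"
      by (simp add: I(2) ennreal_mult del: of_nat_power)
         (simp add: ennreal_of_nat_eq_real_of_nat)
    also have "real (N ^ ?k) * (unit_ball_vol (real ?k) * (real ?k / (2 * real N)) ^ ?k) = ?C"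
      using N(1) by (simp add: power_divide power_mult_distrib)
    finally show ?thesis .
  qed
  then have "hausdorff_measure ?k (coord_cube B 0 1) \<le> ennreal ?C"
    unfolding hausdorff_measure_def by (intro SUP_least) auto
  then show ?thesis
    by (rule order.strict_trans1) simp
qed

lemma prism_coord_cube:
  "prism B (coord_cube B a s) = cbox (coord_proj B a) (\<Sum>b\<in>Basis. (if b \<in> B then a \<bullet> b + s else 1) *\<^sub>R b)"
proof (rule set_eqI)
  fix x :: 'a
  have "x \<in> prism B (coord_cube B a s) \<longleftrightarrow>
    (\<forall>b\<in>B. x \<bullet> b \<in> {a \<bullet> b..a \<bullet> b + s}) \<and> (\<forall>b\<in>Basis - B. x \<bullet> b \<in> {0..1})"
    by (simp add: prism_def coord_proj_in_coord_cube)
  also have "\<dots> \<longleftrightarrow> (\<forall>b\<in>Basis. x \<bullet> b \<in> (if b \<in> B then {a \<bullet> b..a \<bullet> b + s} else {0..1}))"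
    using B by (auto split: if_splits)
  also have "\<dots> \<longleftrightarrow> x \<in> cbox (coord_proj B a) (\<Sum>b\<in>Basis. (if b \<in> B then a \<bullet> b + s else 1) *\<^sub>R b)"
    unfolding mem_box by (intro ball_cong refl) (simp add: coord_proj_inner)
  finally show "x \<in> prism B (coord_cube B a s) \<longleftrightarrow> x \<in> cbox (coord_proj B a) (\<Sum>b\<in>Basis. (if b \<in> B then a \<bullet> b + s else 1) *\<^sub>R b)" .
qed

text \<open>A set of diameter \<open>d\<close> lies in a box with sides \<open>2 d\<close> in the
  directions of \<open>B\<close> around any of its points. Extended by [0, 1] in the other
  directions, the boxes of a cover contain a unit cube of full dimension, so their volumes, and with
  them the charges, cannot sum to something arbitrarily small.\<close>

lemma hausdorff_measure_unit_cube_pos: "0 < hausdorff_measure (card B) (coord_cube B 0 1)"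
proof -
  let ?k = "card B"
  \<comment> \<open>The ratio of the box volume \<open>(2 d) ^ k\<close> to the gauge of a set of
    diameter \<open>d\<close>, as \<open>2 d = 4 (d / 2)\<close>.\<close>
  let ?c = "4 ^ ?k / unit_ball_vol (real ?k)"
  have ubv: "0 < unit_ball_vol (real ?k)"
    by simp
  then have ubv0: "unit_ball_vol (real ?k) \<noteq> 0"
    by linarith
  \<comment> \<open>One scale is enough, since the content at any positive scale is a lower bound
    for the measure.\<close>
  have "\<not> hausdorff_content ?k 1 (coord_cube B 0 1) < ennreal (1 / ?c)"
  proof
    assume "hausdorff_content ?k 1 (coord_cube B 0 1) < ennreal (1 / ?c)"
    then obtain U where U: "coord_cube B 0 1 \<subseteq> (\<Union>i. U i)" "\<And>i::nat. bounded (U i)" "\<And>i. diameter (U i) \<le> 1"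
      and less: "(\<Sum>i. hausdorff_gauge ?k (U i)) < ennreal (1 / ?c)"
      using hausdorff_content_approx by blast
    define lo where "lo i = (\<Sum>b\<in>Basis. (if b \<in> B then (SOME x. x \<in> U i) \<bullet> b - diameter (U i) else 0) *\<^sub>R b)" for i
    define hi where "hi i = (\<Sum>b\<in>Basis. (if b \<in> B then (SOME x. x \<in> U i) \<bullet> b + diameter (U i) else 1) *\<^sub>R b)" for i
    \<comment> \<open>An empty set has gauge 0, also for \<open>k = 0\<close>, where its box would
      still have volume 1; hence it gets no box.\<close>
    define W where "W i = (if U i = {} then {} else cbox (lo i) (hi i))" for i
    have W: "emeasure lborel (W i) = ennreal ?c * hausdorff_gauge ?k (U i)" for i
    proof (cases "U i = {}")
      case False
      have "emeasure lborel (W i) = ennreal ((2 * diameter (U i)) ^ ?k * 1 ^ card (Basis - B))"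
        unfolding W_def using False B diameter_ge_0[OF U(2)[of i]]
        by (simp, intro emeasure_cbox_coord[where r = 1 and s = "2 * diameter (U i)", simplified])
           (auto simp: lo_def hi_def)
      also have "\<dots> = ennreal (?c * (unit_ball_vol (real ?k) * (diameter (U i) / 2) ^ ?k))"
      proof -
        have "(2 * diameter (U i)) ^ ?k = (4 * (diameter (U i) / 2)) ^ ?k"
          by simp
        also have "\<dots> = 4 ^ ?k * (diameter (U i) / 2) ^ ?k"
          by (rule power_mult_distrib)
        finally show ?thesis using ubv0 by simp
      qed
      also have "\<dots> = ennreal ?c * ennreal (unit_ball_vol (real ?k) * (diameter (U i) / 2) ^ ?k)"
        by (rule ennreal_mult') simp
      finally show ?thesis
        using False by (simp only: hausdorff_gauge_def if_False)
    qed (simp add: W_def hausdorff_gauge_def)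
    have "prism B (coord_cube B 0 1) \<subseteq> (\<Union>i. W i)"
    proof
      fix x assume x: "x \<in> prism B (coord_cube B 0 1)"
      then obtain i where i: "coord_proj B x \<in> U i"
        using U(1) by (auto simp: prism_def)
      let ?p = "SOME x. x \<in> U i"
      have "?p \<in> U i"
        using i by (rule someI)
      then have "\<bar>(coord_proj B x - ?p) \<bullet> b\<bar> \<le> diameter (U i)" if "b \<in> Basis" for b
        using Basis_le_norm[OF that, of "coord_proj B x - ?p"] diameter_bounded_bound[OF U(2) i, of ?p]
        by (simp add: dist_norm)
      then have *: "\<bar>x \<bullet> b - ?p \<bullet> b\<bar> \<le> diameter (U i)" if "b \<in> B" "b \<in> Basis" for b
        using coord_proj_inner[of b x] that by (metis inner_diff_left)
      have "x \<in> cbox (lo i) (hi i)"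
        unfolding mem_box
      proof
        fix b :: 'a assume b: "b \<in> Basis"
        show "lo i \<bullet> b \<le> x \<bullet> b \<and> x \<bullet> b \<le> hi i \<bullet> b"
        proof (cases "b \<in> B")
          case True
          have "lo i \<bullet> b = ?p \<bullet> b - diameter (U i)" "hi i \<bullet> b = ?p \<bullet> b + diameter (U i)"
            using True b by (simp_all add: lo_def hi_def)
          then show ?thesis
            using *[OF True b] by linarith
        next
          case False
          have "lo i \<bullet> b = 0" "hi i \<bullet> b = 1"
            using False b by (simp_all add: lo_def hi_def)
          moreover have "x \<bullet> b \<in> {0..1}"
            using x False b by (simp add: prism_def)
          ultimately show ?thesis by simp
        qed
      qed
      then show "x \<in> (\<Union>i. W i)"
        using i by (auto simp: W_def)
    qed
    then have "emeasure lborel (prism B (coord_cube B 0 1)) \<le> emeasure lborel (\<Union>i. W i)"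
      by (intro emeasure_mono) (auto simp: W_def)
    also have "\<dots> \<le> (\<Sum>i. emeasure lborel (W i))"
      by (intro emeasure_subadditive_countably) (auto simp: W_def)
    also have "\<dots> = ennreal ?c * (\<Sum>i. hausdorff_gauge ?k (U i))"
      by (simp add: W)
    also have "\<dots> < ennreal ?c * ennreal (1 / ?c)"
      using less ubv by (intro ennreal_mult_strict_left_mono) (auto simp del: ennreal_1)
    also have "\<dots> = 1"
      using ubv0 by (subst ennreal_mult[symmetric]) auto
    also have "emeasure lborel (prism B (coord_cube B 0 1)) = 1"
      unfolding prism_coord_cube
      by (subst emeasure_cbox_coord[where s = 1 and r = 1]) (use B in \<open>auto simp: coord_proj_inner subsetD\<close>)
    finally show False by simp
  qed
  then have "ennreal (1 / ?c) \<le> hausdorff_measure ?k (coord_cube B 0 1)"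
    using hausdorff_content_le_measure[of 1 ?k "coord_cube B 0 1"] by (auto simp: not_less)
  moreover have "0 < ennreal (1 / ?c)"
    using ubv by simp
  ultimately show ?thesis
    by (rule order.strict_trans2[rotated])
qed

end

section \<open>Proportionality of Hausdorff and Lebesgue measure\<close>

text \<open>The section of \<open>D\<close> by the translate of the span of \<open>B\<close> through
  \<open>t\<close>, moved back to the span of \<open>B\<close>. In this position the sections of a
  cover of the prism over \<open>S\<close> cover \<open>S\<close> itself, for each \<open>t\<close>
  in the unit cube.\<close>

definition slice :: "'a::euclidean_space set \<Rightarrow> 'a \<Rightarrow> 'a set \<Rightarrow> 'a set" where
  "slice B t D = {y. (\<forall>b\<in>Basis - B. y \<bullet> b = 0) \<and> y + coord_proj (Basis - B) t \<in> D}"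

context
  fixes B :: "'a::euclidean_space set"
  assumes B: "B \<subseteq> Basis"
begin

lemma slice_cube:
  assumes "\<And>b. b \<in> Basis \<Longrightarrow> v \<bullet> b = u \<bullet> b + s"
  shows "slice B t (cbox u v) =
    (if \<forall>b\<in>Basis - B. t \<bullet> b \<in> {u \<bullet> b..v \<bullet> b} then coord_cube B u s else {})"
proof -
  have "y \<in> slice B t (cbox u v) \<longleftrightarrow>
    (\<forall>b\<in>Basis - B. t \<bullet> b \<in> {u \<bullet> b..v \<bullet> b}) \<and> y \<in> coord_cube B u s" for y
  proof -
    have in_proj: "coord_proj (Basis - B) t \<bullet> b = (if b \<in> B then 0 else t \<bullet> b)" if "b \<in> Basis" for b
      using coord_proj_inner[of "Basis - B" b t] that by simp
    have "y \<in> slice B t (cbox u v) \<longleftrightarrow> (\<forall>b\<in>Basis - B. y \<bullet> b = 0) \<and>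
      (\<forall>b\<in>Basis. (y + coord_proj (Basis - B) t) \<bullet> b \<in> {u \<bullet> b..v \<bullet> b})"
      by (simp add: slice_def mem_box)
    also have "\<dots> \<longleftrightarrow> (\<forall>b\<in>Basis - B. y \<bullet> b = 0) \<and> (\<forall>b\<in>B. y \<bullet> b \<in> {u \<bullet> b..v \<bullet> b}) \<and>
        (\<forall>b\<in>Basis - B. t \<bullet> b \<in> {u \<bullet> b..v \<bullet> b})"
    proof -
      have "(y + coord_proj (Basis - B) t) \<bullet> b = y \<bullet> b" if "b \<in> B" for b
        using that B in_proj[of b] by (auto simp: inner_add_left)
      moreover have "(y + coord_proj (Basis - B) t) \<bullet> b = y \<bullet> b + t \<bullet> b" if "b \<in> Basis - B" for b
        using that in_proj[of b] by (simp add: inner_add_left)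
      moreover have "(\<forall>b\<in>Basis. P b) \<longleftrightarrow> (\<forall>b\<in>B. P b) \<and> (\<forall>b\<in>Basis - B. P b)" for P
        using B by blast
      ultimately show ?thesis by auto
    qed
    also have "\<dots> \<longleftrightarrow> (\<forall>b\<in>Basis - B. t \<bullet> b \<in> {u \<bullet> b..v \<bullet> b}) \<and> y \<in> coord_cube B u s"
      using subset_BasisD[OF B] assms by (auto simp: coord_cube_def)
    finally show ?thesis .
  qed
  then show ?thesis by auto
qed

text \<open>Cavalieri's principle: a nonempty section is a cube of side \<open>s\<close>, of measure
  proportional to \<open>s ^ card B\<close>, and it occurs for \<open>t\<close> in a box whose sides
  in the complementary directions are \<open>s\<close>. Only an inequality results, because this box
  may reach beyond the unit cube in which \<open>t\<close> varies.\<close>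

lemma nn_integral_slice_cube:
  assumes uv: "\<And>b. b \<in> Basis \<Longrightarrow> v \<bullet> b = u \<bullet> b + s" and s: "0 < s"
  shows "(\<lambda>t. hausdorff_measure (card B) (slice B t (cbox u v))) \<in> borel_measurable borel"
    "(\<integral>\<^sup>+t\<in>cbox 0 One. hausdorff_measure (card B) (slice B t (cbox u v)) \<partial>lborel)
      \<le> hausdorff_measure (card B) (coord_cube B 0 1) * emeasure lborel (cbox u v)"
proof -
  let ?k = "card B" and ?c = "hausdorff_measure (card B) (coord_cube B 0 1)"
  define T where "T = {t::'a. \<forall>b\<in>Basis - B. t \<bullet> b \<in> {u \<bullet> b..v \<bullet> b}}"
  have [measurable]: "T \<in> sets borel"
  proof -
    have "T = (\<Inter>b\<in>Basis - B. {t. u \<bullet> b \<le> t \<bullet> b} \<inter> {t. t \<bullet> b \<le> v \<bullet> b})"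
      by (auto simp: T_def)
    also have "closed \<dots>"
      by (intro closed_INT ballI closed_Int closed_Collect_le continuous_intros)
    finally show ?thesis
      by (rule borel_closed)
  qed
  have eq: "hausdorff_measure ?k (slice B t (cbox u v)) = (ennreal (s ^ ?k) * ?c) * indicator T t" for t
    using hausdorff_measure_coord_cube[OF B s, of ?k u]
    by (simp add: slice_cube[OF uv] T_def indicator_def)
  show "(\<lambda>t. hausdorff_measure ?k (slice B t (cbox u v))) \<in> borel_measurable borel"
    unfolding eq by measurable
  \<comment> \<open>\<open>T\<close> is unbounded in the directions of \<open>B\<close>, where the
    unit cube supplies sides of length 1; in the others the given cube supplies sides of length
    \<open>s\<close>.\<close>
  let ?lo = "\<Sum>b\<in>Basis. (if b \<in> B then 0 else u \<bullet> b) *\<^sub>R b"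
  let ?hi = "\<Sum>b\<in>Basis. (if b \<in> B then 1 else v \<bullet> b) *\<^sub>R b"
  have sub: "T \<inter> cbox 0 One \<subseteq> cbox ?lo ?hi"
    by (auto simp: T_def mem_box)
  have "(\<integral>\<^sup>+t\<in>cbox 0 One. hausdorff_measure ?k (slice B t (cbox u v)) \<partial>lborel)
      = (\<integral>\<^sup>+t. (ennreal (s ^ ?k) * ?c) * indicator (T \<inter> cbox 0 One) t \<partial>lborel)"
    unfolding eq by (intro nn_integral_cong) (auto simp: indicator_def)
  also have "\<dots> = (ennreal (s ^ ?k) * ?c) * emeasure lborel (T \<inter> cbox 0 One)"
    by (rule nn_integral_cmult_indicator) measurable
  also have "\<dots> \<le> (ennreal (s ^ ?k) * ?c) * emeasure lborel (cbox ?lo ?hi)"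
    using sub by (intro mult_left_mono emeasure_mono) auto
  also have "emeasure lborel (cbox ?lo ?hi) = ennreal (s ^ card (Basis - B))"
    using emeasure_cbox_coord[OF B, of ?hi ?lo 1 s] subset_BasisD[OF B] uv s by simp
  also have "(ennreal (s ^ ?k) * ?c) * ennreal (s ^ card (Basis - B))
      = ?c * ennreal (s ^ ?k * s ^ card (Basis - B))"
    using s by (simp add: ennreal_mult mult_ac del: ennreal_power)
  also have "ennreal (s ^ ?k * s ^ card (Basis - B)) = emeasure lborel (cbox u v)"
    using emeasure_cbox_coord[OF B, of v u s s] subset_BasisD[OF B] uv s by simp
  finally show "(\<integral>\<^sup>+t\<in>cbox 0 One. hausdorff_measure ?k (slice B t (cbox u v)) \<partial>lborel)
      \<le> ?c * emeasure lborel (cbox u v)" .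
qed

end

text \<open>Dyadic pieces of one large cube are again cubes. Cubes are wanted because their sections
  parallel to a coordinate subspace are cubes too, whose Hausdorff measure is known by
  scaling.\<close>

lemma bounded_outer_cubes:
  fixes A :: "'a::euclidean_space set"
  assumes A: "bounded A" "A \<in> sets borel" and e: "0 < e"
  obtains D :: "nat \<Rightarrow> 'a set" where "A \<subseteq> (\<Union>i. D i)"
    "\<And>i. D i = {} \<or> (\<exists>u v s. D i = cbox u v \<and> 0 < s \<and> (\<forall>b\<in>Basis. v \<bullet> b = u \<bullet> b + s))"
    "(\<Sum>i. emeasure lborel (D i)) \<le> emeasure lborel A + ennreal e"
proof -
  obtain r where r: "0 < r" "\<And>x. x \<in> A \<Longrightarrow> norm x \<le> r"
    using A(1) unfolding bounded_pos by blast
  let ?a = "- r *\<^sub>R One :: 'a" and ?b = "r *\<^sub>R One :: 'a"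
  have sub: "A \<subseteq> cbox ?a ?b"
  proof
    fix x assume "x \<in> A"
    then have "\<bar>x \<bullet> b\<bar> \<le> r" if "b \<in> Basis" for b
      using Basis_le_norm[OF that, of x] r(2)[of x] by linarith
    then show "x \<in> cbox ?a ?b"
      by (auto simp: mem_box abs_le_iff minus_le_iff)
  qed
  have lm: "A \<in> lmeasurable"
    using A by (intro bounded_set_imp_lmeasurable) auto
  obtain \<D> where \<D>: "countable \<D>"
        "\<And>K. K \<in> \<D> \<Longrightarrow> K \<subseteq> cbox ?a ?b \<and> K \<noteq> {} \<and> (\<exists>c d. K = cbox c d)"
        "pairwise (\<lambda>A B. interior A \<inter> interior B = {}) \<D>"
        "\<And>u v. cbox u v \<in> \<D> \<Longrightarrow> \<exists>n. \<forall>i \<in> Basis. v \<bullet> i - u \<bullet> i = (?b \<bullet> i - ?a \<bullet> i)/2^n"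
        "A \<subseteq> \<Union>\<D>" "\<Union>\<D> \<in> lmeasurable" "measure lebesgue (\<Union>\<D>) \<le> measure lebesgue A + e"
    using measurable_outer_intervals_bounded[OF lm sub e] by metis
  \<comment> \<open>The family may be finite; indices beyond it get the empty set, because the
    default value of \<open>from_nat_into\<close> would count one cube repeatedly.\<close>
  define D where "D i = (if i \<in> to_nat_on \<D> ` \<D> then from_nat_into \<D> i else {})" for i
  have D_in: "D i \<in> \<D>" if "i \<in> to_nat_on \<D> ` \<D>" for i
    using that \<D>(1) by (auto simp: D_def)
  have cover: "\<Union>\<D> = (\<Union>i. D i)"
  proof
    show "\<Union>\<D> \<subseteq> (\<Union>i. D i)"
    proof
      fix x assume "x \<in> \<Union>\<D>"
      then obtain K where "K \<in> \<D>" "x \<in> K" by blast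
      then have "x \<in> D (to_nat_on \<D> K)"
        using \<D>(1) by (simp add: D_def)
      then show "x \<in> (\<Union>i. D i)" by blast
    qed
    show "(\<Union>i. D i) \<subseteq> \<Union>\<D>"
      using D_in by (fastforce simp: D_def split: if_splits)
  qed
  have cubes: "D i = {} \<or> (\<exists>u v s. D i = cbox u v \<and> 0 < s \<and> (\<forall>b\<in>Basis. v \<bullet> b = u \<bullet> b + s))" for i
  proof (cases "i \<in> to_nat_on \<D> ` \<D>")
    case True
    then obtain u v where uv: "D i = cbox u v" "cbox u v \<in> \<D>"
      using D_in[of i] \<D>(2)[of "D i"] by metis
    obtain n where "\<forall>i \<in> Basis. v \<bullet> i - u \<bullet> i = (?b \<bullet> i - ?a \<bullet> i)/2^n"
      using \<D>(4)[OF uv(2)] by blast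
    then have "\<forall>b \<in> Basis. v \<bullet> b = u \<bullet> b + (2 * r) / 2^n"
      by (simp add: field_simps)
    moreover have "0 < (2 * r) / 2^n"
      using r by simp
    ultimately show ?thesis
      using uv(1) by metis
  qed (simp add: D_def)
  \<comment> \<open>The cubes may share faces, but their interiors are disjoint and have the same
    volumes, so the volumes sum to no more than that of the union.\<close>
  have interior: "emeasure lborel (D i) = emeasure lborel (interior (D i))" for i
    using cubes[of i] by (auto simp: interior_cbox emeasure_lborel_box_eq emeasure_lborel_cbox_eq)
  have disj: "disjoint_family (\<lambda>i. interior (D i))"
    unfolding disjoint_family_on_def
  proof (intro ballI impI)
    fix i j :: nat assume ij: "i \<noteq> j"
    show "interior (D i) \<inter> interior (D j) = {}"
    proof (cases "i \<in> to_nat_on \<D> ` \<D> \<and> j \<in> to_nat_on \<D> ` \<D>")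
      case True
      then obtain K L where KL: "K \<in> \<D>" "L \<in> \<D>" "i = to_nat_on \<D> K" "j = to_nat_on \<D> L"
        by blast
      then have "D i = K" "D j = L" "K \<noteq> L"
        using \<D>(1) ij by (auto simp: D_def)
      then show ?thesis
        using pairwiseD[OF \<D>(3) KL(1,2)] by simp
    qed (auto simp: D_def)
  qed
  have "(\<Sum>i. emeasure lborel (D i)) = emeasure lborel (\<Union>i. interior (D i))"
    unfolding interior using disj by (intro suminf_emeasure) auto
  also have "\<dots> = emeasure lebesgue (\<Union>i. interior (D i))"
    by simp
  also have "\<dots> \<le> emeasure lebesgue (\<Union>\<D>)"
    unfolding cover using \<D>(6) interior_subset
    by (intro emeasure_mono) (auto simp: cover)
  also have "\<dots> = ennreal (measure lebesgue (\<Union>\<D>))"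
    using \<D>(6) by (simp add: emeasure_eq_measure2)
  also have "\<dots> \<le> ennreal (measure lebesgue A + e)"
    using \<D>(7) by (rule ennreal_leI)
  also have "\<dots> = emeasure lborel A + ennreal e"
  proof -
    have "ennreal (measure lebesgue A) = emeasure lborel A"
      unfolding emeasure_eq_measure2[OF lm, symmetric] using A(2) by simp
    then show ?thesis
      using e by (simp add: ennreal_plus)
  qed
  finally have "(\<Sum>i. emeasure lborel (D i)) \<le> emeasure lborel A + ennreal e" .
  then show thesis
    using that[of D] cover \<D>(5) cubes by metis
qed

context
  fixes B :: "'a::euclidean_space set"
  assumes B: "B \<subseteq> Basis"
begin

text \<open>A cover of the prism by cubes is sliced by every translate of \<open>S\<close> inside it; averaging
  over these translates turns it into a cover of \<open>S\<close>.\<close>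
lemma hausdorff_measure_le_prism:
  assumes S: "S \<subseteq> range (coord_proj B)" and P: "bounded (prism B S)" "prism B S \<in> sets borel"
  shows "hausdorff_measure (card B) S
    \<le> hausdorff_measure (card B) (coord_cube B 0 1) * emeasure lborel (prism B S)"
proof -
  let ?k = "card B"
  obtain c where c: "0 \<le> c" "hausdorff_measure ?k (coord_cube B 0 1) = ennreal c"
    using hausdorff_measure_unit_cube_finite[OF B] less_top_ennreal by blast
  have "hausdorff_measure ?k S \<le> ennreal c * emeasure lborel (prism B S)"
  proof (rule ennreal_le_epsilon)
    fix e :: real assume e: "0 < e"
    \<comment> \<open>The divisor is \<open>c + 1\<close>, because \<open>c\<close> is only known to
      be nonnegative at this point.\<close>
    define e' where "e' = e / (c + 1)"
    have e': "0 < e'" "c * e' \<le> e"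
      using e c by (auto simp: e'_def field_simps)
    obtain D :: "nat \<Rightarrow> 'a set" where D: "prism B S \<subseteq> (\<Union>i. D i)"
      "\<And>i. D i = {} \<or> (\<exists>u v s. D i = cbox u v \<and> 0 < s \<and> (\<forall>b\<in>Basis. v \<bullet> b = u \<bullet> b + s))"
      "(\<Sum>i. emeasure lborel (D i)) \<le> emeasure lborel (prism B S) + ennreal e'"
      using bounded_outer_cubes[OF P e'(1)] by metis
    have slice_empty: "slice B t {} = {}" for t
      by (simp add: slice_def)
    have meas[measurable]: "(\<lambda>t. hausdorff_measure ?k (slice B t (D i))) \<in> borel_measurable borel" for i
      using D(2)[of i] nn_integral_slice_cube(1)[OF B] by (auto simp: slice_empty)
    have le: "(\<integral>\<^sup>+t\<in>cbox 0 One. hausdorff_measure ?k (slice B t (D i)) \<partial>lborel)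
      \<le> ennreal c * emeasure lborel (D i)" for i
      using D(2)[of i] nn_integral_slice_cube(2)[OF B] unfolding c(2) by (auto simp: slice_empty)
    have pointwise: "hausdorff_measure ?k S \<le> (\<Sum>i. hausdorff_measure ?k (slice B t (D i)))"
      if t: "t \<in> cbox 0 One" for t
    proof -
      have "S \<subseteq> (\<Union>i. slice B t (D i))"
      proof
        fix y assume y: "y \<in> S"
        then have y0: "\<And>b. b \<in> Basis - B \<Longrightarrow> y \<bullet> b = 0"
          using S by (auto simp: coord_proj_inner[OF B])
        have proj: "coord_proj (Basis - B) t \<bullet> b = (if b \<in> B then 0 else t \<bullet> b)" if "b \<in> Basis" for b
          using coord_proj_inner[of "Basis - B" b t] that by simp
        have "coord_proj B (y + coord_proj (Basis - B) t) = y"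
          using y0 subset_BasisD[OF B] by (intro coord_proj_eqI[OF B]) (auto simp: inner_add_left proj)
        moreover have "(y + coord_proj (Basis - B) t) \<bullet> b \<in> {0..1}" if "b \<in> Basis - B" for b
          using that t y0[OF that] proj[of b] by (auto simp: inner_add_left mem_box)
        ultimately have "y + coord_proj (Basis - B) t \<in> prism B S"
          using y by (simp add: prism_def)
        then obtain i where "y + coord_proj (Basis - B) t \<in> D i"
          using D(1) by blast
        then have "y \<in> slice B t (D i)"
          using y0 by (simp add: slice_def)
        then show "y \<in> (\<Union>i. slice B t (D i))"
          by blast
      qed
      then show ?thesis
        using hausdorff_measure_mono hausdorff_measure_UN order_trans by blast
    qed
    \<comment> \<open>The parameter cube has volume 1, so the constant left-hand side equals its own
      integral, while the right-hand side becomes a mean over \<open>t\<close>.\<close>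
    have "emeasure lborel (cbox 0 (One::'a)) = 1"
      by simp
    then have "hausdorff_measure ?k S = (\<integral>\<^sup>+t\<in>cbox 0 (One::'a). hausdorff_measure ?k S \<partial>lborel)"
      by (subst nn_integral_cmult_indicator) auto
    also have "\<dots> \<le> (\<integral>\<^sup>+t\<in>cbox 0 (One::'a). (\<Sum>i. hausdorff_measure ?k (slice B t (D i))) \<partial>lborel)"
      using pointwise by (intro nn_integral_mono) (auto simp: indicator_def)
    also have "\<dots> = (\<Sum>i. \<integral>\<^sup>+t\<in>cbox 0 (One::'a). hausdorff_measure ?k (slice B t (D i)) \<partial>lborel)"
      unfolding ennreal_suminf_multc[symmetric] by (rule nn_integral_suminf) measurable
    also have "\<dots> \<le> (\<Sum>i. ennreal c * emeasure lborel (D i))"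
      by (intro suminf_le le summableI)
    also have "\<dots> = ennreal c * (\<Sum>i. emeasure lborel (D i))"
      by (rule ennreal_suminf_cmult)
    also have "\<dots> \<le> ennreal c * (emeasure lborel (prism B S) + ennreal e')"
      by (intro mult_left_mono D(3)) simp
    also have "\<dots> = ennreal c * emeasure lborel (prism B S) + ennreal (c * e')"
      using c e' by (simp add: distrib_left ennreal_mult)
    also have "\<dots> \<le> ennreal c * emeasure lborel (prism B S) + ennreal e"
      using e' by (intro add_left_mono ennreal_leI)
    finally show "hausdorff_measure ?k S \<le> ennreal c * emeasure lborel (prism B S) + ennreal e" .
  qed
  then show ?thesis unfolding c(2) .
qed

lemma compact_prism:
  assumes "compact S"
  shows "compact (prism B S)"
proof -
  obtain r where r: "\<And>x. x \<in> S \<Longrightarrow> norm x \<le> r"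
    using compact_imp_bounded[OF assms] unfolding bounded_iff by blast
  have "norm x \<le> (\<Sum>b\<in>(Basis::'a set). max r 1)" if x: "x \<in> prism B S" for x
  proof -
    have "\<bar>x \<bullet> b\<bar> \<le> max r 1" if b: "b \<in> Basis" for b
    proof (cases "b \<in> B")
      case True
      then have "\<bar>x \<bullet> b\<bar> \<le> norm (coord_proj B x)"
        using Basis_le_norm[OF b, of "coord_proj B x"] b by (simp add: coord_proj_inner[OF B])
      then show ?thesis
        using x r[of "coord_proj B x"] by (simp add: prism_def)
    next
      case False
      then show ?thesis using x b by (auto simp: prism_def le_max_iff_disj)
    qed
    then have "(\<Sum>b\<in>Basis. \<bar>x \<bullet> b\<bar>) \<le> (\<Sum>b\<in>(Basis::'a set). max r 1)"
      by (rule sum_mono)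
    then show ?thesis
      using norm_le_l1[of x] by linarith
  qed
  then have "bounded (prism B S)"
    unfolding bounded_iff by blast
  moreover have "closed (prism B S)"
  proof -
    have "prism B S = (coord_proj B -` S) \<inter> (\<Inter>b\<in>Basis - B. {x. 0 \<le> x \<bullet> b} \<inter> {x. x \<bullet> b \<le> 1})"
      by (auto simp: prism_def)
    also have "closed \<dots>"
      using compact_imp_closed[OF assms] continuous_coord_proj[OF B, of UNIV]
      by (intro closed_Int closed_INT ballI closed_Collect_le continuous_intros continuous_closed_vimage)
         (auto simp: continuous_on_eq_continuous_at)
    finally show ?thesis .
  qed
  ultimately show ?thesis
    by (simp add: compact_eq_bounded_closed)
qed

text \<open>The upper bound applies to \<open>S\<close> and also to \<open>Q - S\<close> for a cube
  \<open>Q\<close> around \<open>S\<close>. On \<open>Q\<close> equality holds by scaling, so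
  subadditivity allows no loss in either bound: \<open>?c vol(S) + ?c vol(Q - S) = H(Q) \<le> H(S) +
  H(Q - S) \<le> H(S) + ?c vol(Q - S)\<close>, where \<open>vol\<close> is the volume of the prism,
  and the last term cancels.\<close>

theorem hausdorff_measure_eq_prism:
  assumes S: "compact S" "S \<subseteq> range (coord_proj B)"
  shows "hausdorff_measure (card B) S
    = hausdorff_measure (card B) (coord_cube B 0 1) * emeasure lborel (prism B S)"
proof (rule antisym)
  let ?k = "card B" and ?c = "hausdorff_measure (card B) (coord_cube B 0 1)"
  have cS: "compact (prism B S)"
    by (rule compact_prism[OF S(1)])
  show "hausdorff_measure ?k S \<le> ?c * emeasure lborel (prism B S)"
    using cS by (intro hausdorff_measure_le_prism S(2) compact_imp_bounded borel_closed compact_imp_closed)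
  obtain r where r: "0 < r" "\<And>x. x \<in> S \<Longrightarrow> norm x \<le> r"
    using compact_imp_bounded[OF S(1)] unfolding bounded_pos by blast
  define Q where "Q = coord_cube B (- r *\<^sub>R One) (2 * r)"
  have Q_range: "Q \<subseteq> range (coord_proj B)"
  proof
    fix y assume "y \<in> Q"
    then have "coord_proj B y = y"
      by (intro coord_proj_eqI[OF B]) (auto simp: Q_def coord_cube_def)
    then show "y \<in> range (coord_proj B)"
      by (metis rangeI)
  qed
  have SQ: "S \<subseteq> Q"
  proof
    fix x assume x: "x \<in> S"
    have "x \<bullet> b \<in> {- r..r}" if "b \<in> B" for b
      using Basis_le_norm[OF subset_BasisD[OF B that], of x] r(2)[OF x] by (auto simp: abs_le_iff)
    moreover have "x \<bullet> b = 0" if "b \<in> Basis - B" for b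
      using S(2) x that by (auto simp: coord_proj_inner[OF B])
    ultimately show "x \<in> Q"
      using subset_BasisD[OF B] by (auto simp: Q_def coord_cube_def)
  qed
  have pQ: "prism B Q = cbox (coord_proj B (- r *\<^sub>R One)) (\<Sum>b\<in>Basis. (if b \<in> B then (- r *\<^sub>R One) \<bullet> b + 2 * r else 1) *\<^sub>R b)"
    unfolding Q_def by (rule prism_coord_cube[OF B])
  have mQ: "emeasure lborel (prism B Q) = ennreal ((2 * r) ^ ?k)"
    unfolding pQ using emeasure_cbox_coord[OF B, where s = "2 * r" and r = 1] r subset_BasisD[OF B]
    by (subst emeasure_cbox_coord[OF B, where s = "2 * r" and r = 1]) (simp_all add: coord_proj_inner[OF B])
  have diff: "prism B (Q - S) = prism B Q - prism B S"
    by (auto simp: prism_def)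
  have sub: "prism B S \<subseteq> prism B Q"
    using SQ by (auto simp: prism_def)
  have borel: "prism B S \<in> sets borel" "prism B Q \<in> sets borel"
    using cS by (auto simp: pQ intro!: borel_closed compact_imp_closed)
  have vol: "emeasure lborel (prism B Q) = emeasure lborel (prism B S) + emeasure lborel (prism B (Q - S))"
    unfolding diff using sub borel by (subst plus_emeasure) (auto simp: Un_absorb1)
  have "?c * emeasure lborel (prism B S) + ?c * emeasure lborel (prism B (Q - S)) = hausdorff_measure ?k Q"
    unfolding distrib_left[symmetric] vol[symmetric] mQ unfolding Q_def
    using r hausdorff_measure_coord_cube[OF B, of "2 * r"] by (simp add: mult.commute)
  also have "\<dots> \<le> hausdorff_measure ?k S + hausdorff_measure ?k (Q - S)"
    using hausdorff_measure_Un[of ?k S "Q - S"] SQ by (simp add: Un_absorb1)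
  also have "\<dots> \<le> hausdorff_measure ?k S + ?c * emeasure lborel (prism B (Q - S))"
  proof (intro add_left_mono hausdorff_measure_le_prism)
    show "Q - S \<subseteq> range (coord_proj B)" using Q_range by blast
    show "bounded (prism B (Q - S))"
      unfolding diff by (rule bounded_subset[of "prism B Q"]) (auto simp: pQ)
    show "prism B (Q - S) \<in> sets borel"
      unfolding diff using borel by blast
  qed
  finally have "?c * emeasure lborel (prism B (Q - S)) + ?c * emeasure lborel (prism B S)
      \<le> ?c * emeasure lborel (prism B (Q - S)) + hausdorff_measure ?k S"
    by (simp add: add.commute)
  \<comment> \<open>Cancelling this term on both sides in \<open>ennreal\<close> requires that it is
    finite.\<close>
  moreover have "?c * emeasure lborel (prism B (Q - S)) \<noteq> top"
  proof -
    have "emeasure lborel (prism B (Q - S)) \<le> emeasure lborel (prism B Q)"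
      using borel by (intro emeasure_mono) (auto simp: diff)
    also have "\<dots> < top"
      by (simp add: mQ)
    finally show ?thesis
      using hausdorff_measure_unit_cube_finite[OF B] by (auto simp: ennreal_mult_eq_top_iff less_top)
  qed
  ultimately show "?c * emeasure lborel (prism B S) \<le> hausdorff_measure ?k S"
    by (simp add: ennreal_add_left_cancel_le)
qed

end

section \<open>Solids of tent shape\<close>

text \<open>\<open>\<Phi> x t\<close> is \<open>\<phi>\<close> at \<open>x\<close> with the
  coordinate \<open>m\<close> replaced by \<open>t\<close>. Integrating that coordinate out leaves a
  slab of thickness 1 in its place, so the integral stays over the whole space and the step can be
  repeated for further coordinates.\<close>

lemma nn_integral_coordinate:
  fixes \<phi> :: "real ^ 'n \<Rightarrow> ennreal" and \<Phi> :: "real ^ 'n \<Rightarrow> real \<Rightarrow> ennreal"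
  assumes \<phi>: "\<phi> \<in> borel_measurable borel" and \<Phi>: "\<And>x. \<Phi> x \<in> borel_measurable borel"
    and shift: "\<And>x t. \<phi> (x + t *\<^sub>R axis m 1) = \<Phi> x (x $ m + t)"
  shows "(\<integral>\<^sup>+x. \<phi> x \<partial>lborel) = (\<integral>\<^sup>+x. indicator {0..1} (x $ m) * (\<integral>\<^sup>+t. \<Phi> x t \<partial>lborel) \<partial>lborel)"
proof -
  have "(\<integral>\<^sup>+x. \<phi> x \<partial>lborel) = ennreal 1 * (\<integral>\<^sup>+x. \<phi> x \<partial>lborel)"
    by simp
  also have "\<dots> = (\<integral>\<^sup>+x. indicator {0..1} (axis m 1 \<bullet> x) * (\<integral>\<^sup>+t. \<phi> (x + t *\<^sub>R axis m 1) \<partial>lborel) \<partial>lborel)"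
    by (rule nn_integral_slab[symmetric]) (use \<phi> in \<open>auto simp: norm_axis_1\<close>)
  also have "\<dots> = (\<integral>\<^sup>+x. indicator {0..1} (x $ m) * (\<integral>\<^sup>+t. \<Phi> x t \<partial>lborel) \<partial>lborel)"
  proof (rule nn_integral_cong)
    fix x
    have "(\<integral>\<^sup>+t. \<phi> (x + t *\<^sub>R axis m 1) \<partial>lborel) = (\<integral>\<^sup>+t. \<Phi> x t \<partial>lborel)"
      unfolding shift using nn_integral_lborel_translate[OF \<Phi>, of x "x $ m"] by (simp add: add.commute)
    then show "indicator {0..1} (axis m 1 \<bullet> x) * (\<integral>\<^sup>+t. \<phi> (x + t *\<^sub>R axis m 1) \<partial>lborel)
      = indicator {0..1} (x $ m) * (\<integral>\<^sup>+t. \<Phi> x t \<partial>lborel)"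
      by (simp add: inner_axis' )
  qed
  finally show ?thesis .
qed

text \<open>Over each value of coordinate \<open>j\<close> the section is a box: \<open>p\<close> is
  its length in direction \<open>i\<close>, \<open>q\<close> its height in the direction
  \<open>k\<close> of projection, \<open>r\<close> its side in all remaining directions. Box,
  pyramid and their sum have this form, and so do their shadows (\<open>q\<close> zero) and the
  prisms over these (\<open>q\<close> one).\<close>

definition tent :: "'n \<Rightarrow> 'n \<Rightarrow> 'n \<Rightarrow> real \<Rightarrow> (real \<Rightarrow> real) \<Rightarrow> (real \<Rightarrow> real) \<Rightarrow> real \<Rightarrow> (real ^ 'n::finite) set" where
  "tent i j k b p q r = {x. x $ j \<in> {0..b} \<and> x $ i \<in> {0..p (x $ j)} \<and> x $ k \<in> {0..q (x $ j)} \<and>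
    (\<forall>l. l \<notin> {i, j, k} \<longrightarrow> x $ l \<in> {0..r})}"

context
  fixes i j k :: "'n::finite"
  assumes ijk: "i \<noteq> j" "i \<noteq> k" "j \<noteq> k"
begin

lemma emeasure_tent:
  assumes [measurable]: "p \<in> borel_measurable borel" "q \<in> borel_measurable borel"
  shows "emeasure lborel (tent i j k b p q r) =
    emeasure lborel (cbox 0 (\<chi> l. if l \<in> {i, j, k} then 1 else r) :: (real ^ 'n) set) *
    (\<integral>\<^sup>+y. ennreal (p y) * ennreal (q y) * indicator {0..b} y \<partial>lborel)"
proof -
  define G :: "real ^ 'n \<Rightarrow> ennreal" where "G x = (\<Prod>l\<in>- {i, j, k}. indicator {0..r} (x $ l))" for x
  have G_ind: "G x = (if \<forall>l. l \<notin> {i, j, k} \<longrightarrow> x $ l \<in> {0..r} then 1 else 0)" for x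
    by (auto simp: G_def indicator_def intro!: prod.neutral)
  have [measurable]: "G \<in> borel_measurable borel"
    unfolding G_def by measurable
  have G_shift: "G (x + t *\<^sub>R axis m 1) = G x" if "m \<in> {i, j, k}" for x t m
    unfolding G_def using that by (intro prod.cong refl) (auto simp: axis_def)
  have shift: "axis m (1::real) $ l = (if l = m then 1 else 0)" for m l :: 'n
    by (simp add: axis_def)
  \<comment> \<open>This includes negative \<open>c\<close>, where the interval is empty and
    \<open>ennreal\<close> truncates to 0.\<close>
  have length_Icc: "emeasure lborel {0..c} = ennreal c" for c :: real
    by (cases "0 \<le> c") (auto simp: ennreal_neg)
  let ?I = "\<integral>\<^sup>+y. ennreal (p y) * ennreal (q y) * indicator {0..b} y \<partial>lborel"
  let ?u = "indicator {0..1} :: real \<Rightarrow> ennreal"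
  let ?f = "\<lambda>x::real ^ 'n. G x * indicator {0..b} (x $ j) * indicator {0..p (x $ j)} (x $ i) * indicator {0..q (x $ j)} (x $ k)"
  have ind_meas: "(\<lambda>x. indicator {0..f x} (g x) :: ennreal) \<in> borel_measurable borel"
    if [measurable]: "f \<in> borel_measurable borel" "g \<in> borel_measurable borel"
    for f g :: "real ^ 'n \<Rightarrow> real"
  proof -
    have "(\<lambda>x. indicator {0..f x} (g x) :: ennreal) = indicator {x. 0 \<le> g x \<and> g x \<le> f x}"
      by (auto simp: indicator_def)
    then show ?thesis by simp
  qed
  have [measurable]: "(\<lambda>x::real ^ 'n. indicator {0..p (x $ j)} (x $ i) :: ennreal) \<in> borel_measurable borel"
     "(\<lambda>x::real ^ 'n. indicator {0..q (x $ j)} (x $ k) :: ennreal) \<in> borel_measurable borel"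
    by (rule ind_meas; measurable)+
  have ind_f: "indicator (tent i j k b p q r) x = ?f x" for x
    by (auto simp: tent_def G_ind indicator_def)
  then have "indicator (tent i j k b p q r) = ?f"
    by (rule ext)
  then have "?f = indicator (tent i j k b p q r)"
    by simp
  moreover have "?f \<in> borel_measurable borel"
    by measurable
  ultimately have meas: "tent i j k b p q r \<in> sets borel"
    using borel_measurable_indicator_iff[of "tent i j k b p q r" borel, where ?'x = ennreal] by simp
  have "emeasure lborel (tent i j k b p q r) = (\<integral>\<^sup>+x. ?f x \<partial>lborel)"
    unfolding ind_f[symmetric] using meas by simp
  \<comment> \<open>The coordinates \<open>k\<close> and \<open>i\<close> are integrated out before
    \<open>j\<close>, on which their ranges depend.\<close>
  also have "\<dots> = (\<integral>\<^sup>+x. ?u (x $ k) * (\<integral>\<^sup>+t. G x * indicator {0..b} (x $ j) * indicator {0..p (x $ j)} (x $ i) *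
      indicator {0..q (x $ j)} t \<partial>lborel) \<partial>lborel)"
    by (rule nn_integral_coordinate) (use ijk in \<open>simp_all add: shift G_shift\<close>)
  also have "\<dots> = (\<integral>\<^sup>+x. ?u (x $ k) * (G x * indicator {0..b} (x $ j) * indicator {0..p (x $ j)} (x $ i) *
      ennreal (q (x $ j))) \<partial>lborel)"
    by (simp add: nn_integral_cmult length_Icc)
  also have "\<dots> = (\<integral>\<^sup>+x. ?u (x $ i) * (\<integral>\<^sup>+t. ?u (x $ k) * (G x * indicator {0..b} (x $ j) * ennreal (q (x $ j))) *
      indicator {0..p (x $ j)} t \<partial>lborel) \<partial>lborel)"
    by (rule nn_integral_coordinate) (use ijk in \<open>simp_all add: shift G_shift mult_ac\<close>)
  also have "\<dots> = (\<integral>\<^sup>+x. ?u (x $ i) * (?u (x $ k) * (G x * indicator {0..b} (x $ j) * ennreal (q (x $ j))) *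
      ennreal (p (x $ j))) \<partial>lborel)"
    by (simp add: nn_integral_cmult length_Icc)
  also have "\<dots> = (\<integral>\<^sup>+x. ?u (x $ j) * (\<integral>\<^sup>+t. (?u (x $ i) * ?u (x $ k) * G x) *
      (ennreal (p t) * ennreal (q t) * indicator {0..b} t) \<partial>lborel) \<partial>lborel)"
    by (rule nn_integral_coordinate) (use ijk in \<open>simp_all add: shift G_shift mult_ac\<close>)
  also have "\<dots> = (\<integral>\<^sup>+x. ?u (x $ j) * ((?u (x $ i) * ?u (x $ k) * G x) * ?I) \<partial>lborel)"
    by (simp add: nn_integral_cmult)
  also have "\<dots> = (\<integral>\<^sup>+x. (?u (x $ j) * ?u (x $ i) * ?u (x $ k) * G x) * ?I \<partial>lborel)"
    by (simp add: mult_ac)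
  also have "\<dots> = (\<integral>\<^sup>+x. ?u (x $ j) * ?u (x $ i) * ?u (x $ k) * G x \<partial>lborel) * ?I"
    by (rule nn_integral_multc) measurable
  \<comment> \<open>The slabs left behind by the three integrations and the factor \<open>G\<close>
    for the other coordinates make up a box.\<close>
  also have "(\<lambda>x. ?u (x $ j) * ?u (x $ i) * ?u (x $ k) * G x) = indicator (cbox 0 (\<chi> l. if l \<in> {i, j, k} then 1 else r))"
  proof
    fix x :: "real ^ 'n"
    show "?u (x $ j) * ?u (x $ i) * ?u (x $ k) * G x = indicator (cbox 0 (\<chi> l. if l \<in> {i, j, k} then 1 else r)) x"
      unfolding G_ind indicator_def mem_box_cart by auto
  qed
  finally show ?thesis by simp
qed

lemma compact_tent:
  assumes p: "continuous_on UNIV p" and q: "continuous_on UNIV q"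
  shows "compact (tent i j k b p q r)"
proof -
  have "bounded (p ` {0..b})" "bounded (q ` {0..b})"
    using p q by (auto intro!: compact_imp_bounded compact_continuous_image intro: continuous_on_subset)
  then obtain P Q where PQ: "\<And>y. y \<in> {0..b} \<Longrightarrow> \<bar>p y\<bar> \<le> P" "\<And>y. y \<in> {0..b} \<Longrightarrow> \<bar>q y\<bar> \<le> Q"
    unfolding bounded_iff by (auto simp del: atLeastAtMost_iff)
  have "tent i j k b p q r \<subseteq> cbox 0 (\<chi> l. if l = j then b else if l = i then P else if l = k then Q else r)"
    using PQ by (fastforce simp: tent_def mem_box_cart)
  then have "bounded (tent i j k b p q r)"
    by (rule bounded_subset[OF bounded_cbox])
  moreover have "closed (tent i j k b p q r)"
  proof -
    have [continuous_intros]: "continuous_on UNIV (\<lambda>x::real ^ 'n. p (x $ j))" "continuous_on UNIV (\<lambda>x::real ^ 'n. q (x $ j))"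
      by (rule continuous_on_compose2[OF p] continuous_on_compose2[OF q]; auto intro!: continuous_intros)+
    have "tent i j k b p q r = {x. 0 \<le> x $ j} \<inter> {x. x $ j \<le> b} \<inter> {x. 0 \<le> x $ i} \<inter> {x. x $ i \<le> p (x $ j)}
      \<inter> {x. 0 \<le> x $ k} \<inter> {x. x $ k \<le> q (x $ j)} \<inter> (\<Inter>l\<in>- {i, j, k}. {x. 0 \<le> x $ l} \<inter> {x. x $ l \<le> r})"
      by (auto simp: tent_def)
    also have "closed \<dots>"
      by (intro closed_Int closed_INT ballI closed_Collect_le continuous_intros)
    finally show ?thesis .
  qed
  ultimately show ?thesis
    by (simp add: compact_eq_bounded_closed)
qed

lemma convex_tent:
  assumes p: "concave_on UNIV p" and q: "concave_on UNIV q"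
  shows "convex (tent i j k b p q r)"
proof (rule convexI)
  fix x y :: "real ^ 'n" and s t :: real
  assume xy: "x \<in> tent i j k b p q r" "y \<in> tent i j k b p q r" and st: "0 \<le> s" "0 \<le> t" "s + t = 1"
  have comb: "s * \<alpha> + t * \<beta> \<in> {0..s * c + t * d}" if "\<alpha> \<in> {0..c}" "\<beta> \<in> {0..d}" for \<alpha> \<beta> c d
    using that st by (auto intro!: add_nonneg_nonneg add_mono mult_left_mono)
  have comb1: "s * \<alpha> + t * \<beta> \<in> {0..c}" if "\<alpha> \<in> {0..c}" "\<beta> \<in> {0..c}" for \<alpha> \<beta> c
    using comb[OF that] st(3) by (simp flip: distrib_right)
  have pq: "s * p (x $ j) + t * p (y $ j) \<le> p (s * x $ j + t * y $ j)"
      "s * q (x $ j) + t * q (y $ j) \<le> q (s * x $ j + t * y $ j)"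
    using p q st unfolding concave_on_iff by auto
  show "s *\<^sub>R x + t *\<^sub>R y \<in> tent i j k b p q r"
    using xy comb1[of "x $ j" b "y $ j"] comb[of "x $ i" "p (x $ j)" "y $ i" "p (y $ j)"]
      comb[of "x $ k" "q (x $ j)" "y $ k" "q (y $ j)"] comb1[of "x $ _" r "y $ _"] pq
    unfolding tent_def by (auto intro: order_trans)
qed

section \<open>Projections of tents and their Hausdorff measure\<close>

lemma perp_proj_axis:
  fixes x :: "real ^ 'n"
  shows "perp_proj (axis k 1) x = (\<chi> l. if l = k then 0 else x $ l)"
proof -
  have "perp_proj (axis k 1) x = x - (axis k 1 \<bullet> x) *\<^sub>R axis k 1"
    by (rule perp_proj_unit) (rule norm_axis_1)
  moreover have "axis k 1 \<bullet> x = x $ k"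
    by (simp add: inner_axis')
  ultimately show ?thesis
    by (auto simp: vec_eq_iff axis_def)
qed

text \<open>A nonnegative \<open>q\<close> puts the point at height 0 into every vertical fibre over
  the base, so the shadow is the bottom face of the tent.\<close>

lemma perp_proj_tent:
  assumes "\<And>y. y \<in> {0..b} \<Longrightarrow> 0 \<le> q y"
  shows "perp_proj (axis k 1) ` tent i j k b p q r = tent i j k b p (\<lambda>_. 0) r"
proof
  show "perp_proj (axis k 1) ` tent i j k b p q r \<subseteq> tent i j k b p (\<lambda>_. 0) r"
    using ijk by (auto simp: perp_proj_axis tent_def)
  show "tent i j k b p (\<lambda>_. 0) r \<subseteq> perp_proj (axis k 1) ` tent i j k b p q r"
  proof
    fix x assume x: "x \<in> tent i j k b p (\<lambda>_. 0) r"
    then have "x = perp_proj (axis k 1) x"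
      by (auto simp: perp_proj_axis tent_def vec_eq_iff)
    moreover have "x \<in> tent i j k b p q r"
      using x assms by (auto simp: tent_def)
    ultimately show "x \<in> perp_proj (axis k 1) ` tent i j k b p q r"
      by blast
  qed
qed

lemma coord_proj_axis:
  fixes x :: "real ^ 'n"
  shows "coord_proj (Basis - {axis k 1}) x = (\<chi> l. if l = k then 0 else x $ l)"
proof (rule coord_proj_eqI)
  fix b :: "real ^ 'n" assume "b \<in> Basis - {axis k 1}"
  then obtain l where "b = axis l 1" "l \<noteq> k"
    by (auto simp: Basis_vec_def)
  then show "x \<bullet> b = (\<chi> l. if l = k then 0 else x $ l) \<bullet> b"
    by (simp add: inner_axis)
next
  fix b :: "real ^ 'n" assume "b \<in> Basis - (Basis - {axis k 1})"
  then have "b = axis k 1" by simp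
  then show "(\<chi> l. if l = k then 0 else x $ l) \<bullet> b = 0"
    by (simp add: inner_axis)
qed simp

text \<open>The only missing direction is \<open>k\<close>, so the prism over the flat tent is the
  tent of constant height 1; base areas thus become volumes of tents.\<close>

lemma hausdorff_measure_base:
  assumes p: "continuous_on UNIV p"
  shows "hausdorff_measure (CARD('n) - 1) (tent i j k b p (\<lambda>_. 0) r)
    = hausdorff_measure (CARD('n) - 1) (coord_cube (Basis - {axis k 1 :: real ^ 'n}) 0 1)
      * emeasure lborel (tent i j k b p (\<lambda>_. 1) r)"
proof -
  let ?B = "Basis - {axis k 1 :: real ^ 'n}"
  have card: "card ?B = CARD('n) - 1"
    by (subst card_Diff_singleton) (auto simp: axis_in_Basis_iff)
  have "tent i j k b p (\<lambda>_. 0) r \<subseteq> range (coord_proj ?B)"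
  proof
    fix x assume "x \<in> tent i j k b p (\<lambda>_. 0) r"
    then have "coord_proj ?B x = x"
      by (auto simp: coord_proj_axis tent_def vec_eq_iff)
    then show "x \<in> range (coord_proj ?B)"
      by (metis rangeI)
  qed
  moreover have "Basis - ?B = {axis k 1}"
    by (auto simp: axis_in_Basis_iff)
  then have "prism ?B (tent i j k b p (\<lambda>_. 0) r) = tent i j k b p (\<lambda>_. 1) r"
    using ijk by (auto simp: prism_def coord_proj_axis tent_def inner_axis)
  ultimately show ?thesis
    using hausdorff_measure_eq_prism[of ?B "tent i j k b p (\<lambda>_. 0) r"] compact_tent[OF p] card by simp
qed

end

section \<open>The two parts of the theorem\<close>

lemma nn_integral_affine_product:
  fixes \<alpha> \<beta> :: real
  assumes "0 \<le> \<alpha>" "0 \<le> \<beta>" "0 \<le> \<gamma>" "0 \<le> \<delta>" "0 \<le> b"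
  shows "(\<integral>\<^sup>+y. ennreal (\<alpha> + \<beta> * y) * ennreal (\<gamma> + \<delta> * y) * indicator {0..b} y \<partial>lborel)
    = ennreal (\<alpha> * \<gamma> * b + (\<alpha> * \<delta> + \<beta> * \<gamma>) * b^2 / 2 + \<beta> * \<delta> * b^3 / 3)"
proof -
  let ?F = "\<lambda>y. \<alpha> * \<gamma> * y + (\<alpha> * \<delta> + \<beta> * \<gamma>) * y^2 / 2 + \<beta> * \<delta> * y^3 / 3"
  have "(\<integral>\<^sup>+y. ennreal (\<alpha> + \<beta> * y) * ennreal (\<gamma> + \<delta> * y) * indicator {0..b} y \<partial>lborel)
    = (\<integral>\<^sup>+y. ennreal ((\<alpha> + \<beta> * y) * (\<gamma> + \<delta> * y)) * indicator {0..b} y \<partial>lborel)"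
    using assms by (intro nn_integral_cong) (auto simp: indicator_def ennreal_mult)
  also have "\<dots> = ennreal (?F b - ?F 0)"
  proof (rule nn_integral_FTC_Icc)
    fix x assume "x \<in> {0..b}"
    show "(?F has_real_derivative (\<alpha> + \<beta> * x) * (\<gamma> + \<delta> * x)) (at x)"
      by (auto intro!: derivative_eq_intros simp: field_simps power2_eq_square)
  qed (use assms in auto)
  finally show ?thesis by simp
qed

text \<open>Meant for the profiles of the sum, which grow up to 1 and then stay constant on a
  plateau of length \<open>b - 1\<close>.\<close>

lemma nn_integral_truncated:
  fixes f :: "real \<Rightarrow> ennreal"
  assumes [measurable]: "f \<in> borel_measurable borel" and b: "1 \<le> b"
  shows "(\<integral>\<^sup>+y. f (min 1 y) * indicator {0..b} y \<partial>lborel)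
    = (\<integral>\<^sup>+y. f y * indicator {0..1} y \<partial>lborel) + f 1 * ennreal (b - 1)"
proof -
  have "(\<integral>\<^sup>+y. f (min 1 y) * indicator {0..b} y \<partial>lborel)
    = (\<integral>\<^sup>+y. f y * indicator {0..1} y + f 1 * indicator {1<..b} y \<partial>lborel)"
    using b by (intro nn_integral_cong) (auto simp: indicator_def min_def)
  also have "\<dots> = (\<integral>\<^sup>+y. f y * indicator {0..1} y \<partial>lborel) + (\<integral>\<^sup>+y. f 1 * indicator {1<..b} y \<partial>lborel)"
    by (rule nn_integral_add) measurable
  also have "(\<integral>\<^sup>+y. f 1 * indicator {1<..b} y \<partial>lborel) = f 1 * ennreal (b - 1)"
    using b by (subst nn_integral_cmult_indicator) auto
  finally show ?thesis .
qed

text \<open>The case \<open>B = Basis\<close>: no coordinate is missing, and the prism is the set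
  itself.\<close>

lemma hausdorff_measure_full:
  fixes K :: "'a::euclidean_space set"
  assumes "compact K"
  shows "hausdorff_measure DIM('a) K = hausdorff_measure DIM('a) (coord_cube Basis (0::'a) 1) * emeasure lborel K"
proof -
  have id: "coord_proj Basis = (\<lambda>x::'a. x)"
    by (simp add: coord_proj_def euclidean_representation fun_eq_iff)
  then have "prism Basis K = K"
    by (simp add: prism_def)
  then show ?thesis
    using hausdorff_measure_eq_prism[of Basis K] assms id by simp
qed

text \<open>If the projection of \<open>K\<close> is that of \<open>L\<close> scaled by
  \<open>c\<close>, then by convexity the projection of \<open>K + L\<close> is that of
  \<open>L\<close> scaled by \<open>1 + c\<close>. All denominators are then powers of
  \<open>c\<close>, 1 and \<open>1 + c\<close> times one number \<open>m\<close>, all numerators are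
  volumes times one constant \<open>h\<close>, and the claim is the estimate for homothetic
  projections divided by \<open>(1 + c) ^ (?n - 1)\<close> and by \<open>m\<close>.\<close>

lemma ratio_superadditive:
  fixes u :: "'a::euclidean_space"
  assumes u: "norm u = 1" and K: "convex_body K" and L: "convex_body L"
    and hom: "homothetic_sets (perp_proj u ` K) (perp_proj u ` L)"
  shows "hausdorff_measure DIM('a) K / hausdorff_measure (DIM('a) - 1) (perp_proj u ` K)
       + hausdorff_measure DIM('a) L / hausdorff_measure (DIM('a) - 1) (perp_proj u ` L)
     \<le> hausdorff_measure DIM('a) (K + L) / hausdorff_measure (DIM('a) - 1) (perp_proj u ` (K + L))"
proof -
  let ?n = "DIM('a)" and ?PK = "perp_proj u ` K" and ?PL = "perp_proj u ` L"
  have K': "compact K" "convex K" "K \<noteq> {}" and L': "compact L" "convex L" "L \<noteq> {}"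
    using K L by (auto simp: convex_body_def)
  obtain c a where c: "0 < c" and hom: "?PK = (\<lambda>x. c *\<^sub>R x + a) ` ?PL"
    using hom by (auto simp: homothetic_sets_def)
  have lin: "linear (perp_proj u)"
    by (rule linearI) (simp_all add: perp_proj_unit[OF u] algebra_simps inner_add_right)
  have PKL: "perp_proj u ` (K + L) = (\<lambda>x. (1 + c) *\<^sub>R x + a) ` ?PL"
  proof
    show "perp_proj u ` (K + L) \<subseteq> (\<lambda>x. (1 + c) *\<^sub>R x + a) ` ?PL"
    proof (rule image_subsetI)
      fix z assume "z \<in> K + L"
      then obtain x y where xy: "x \<in> K" "y \<in> L" "z = x + y"
        by (rule set_plus_elim)
      then obtain v where v: "v \<in> L" "perp_proj u x = c *\<^sub>R perp_proj u v + a"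
        using hom by auto
      \<comment> \<open>\<open>c v + y\<close> is \<open>1 + c\<close> times this convex combination
        of \<open>v\<close> and \<open>y\<close>.\<close>
      let ?w = "(c / (1 + c)) *\<^sub>R v + (1 / (1 + c)) *\<^sub>R y"
      have "?w \<in> L"
        using v xy c by (intro convexD[OF L'(2)]) (auto simp: field_simps)
      moreover have "perp_proj u z = (1 + c) *\<^sub>R perp_proj u ?w + a"
        using c by (simp add: xy v linear_add[OF lin] linear_cmul[OF lin] scaleR_add_right)
      ultimately show "perp_proj u z \<in> (\<lambda>x. (1 + c) *\<^sub>R x + a) ` ?PL"
        by blast
    qed
    show "(\<lambda>x. (1 + c) *\<^sub>R x + a) ` ?PL \<subseteq> perp_proj u ` (K + L)"
    proof (clarsimp)
      fix y assume y: "y \<in> L"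
      then have "c *\<^sub>R perp_proj u y + a \<in> ?PK"
        unfolding hom by blast
      then obtain x where "x \<in> K" "perp_proj u x = c *\<^sub>R perp_proj u y + a"
        by auto
      then have "(1 + c) *\<^sub>R perp_proj u y + a = perp_proj u (x + y)" "x + y \<in> K + L"
        using y by (auto simp: linear_add[OF lin] algebra_simps)
      then show "(1 + c) *\<^sub>R perp_proj u y + a \<in> perp_proj u ` (K + L)"
        by blast
    qed
  qed
  define m where "m = hausdorff_measure (?n - 1) ?PL"
  define h where "h = hausdorff_measure ?n (coord_cube Basis (0::'a) 1)"
  have mK: "hausdorff_measure (?n - 1) ?PK = ennreal (c ^ (?n - 1)) * m"
    unfolding m_def hom by (rule hausdorff_measure_affine[OF c])
  have mKL: "hausdorff_measure (?n - 1) (perp_proj u ` (K + L)) = ennreal ((1 + c) ^ (?n - 1)) * m"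
    unfolding m_def PKL using c by (intro hausdorff_measure_affine) simp
  \<comment> \<open>This holds for every \<open>m\<close>, including 0 and \<open>top\<close>, since
    \<open>ennreal s\<close> is positive and finite.\<close>
  have div: "x / (ennreal s * m) = (x / ennreal s) / m" if "0 < s" for x s
    using that by (simp add: divide_ennreal_def ennreal_inverse_mult' mult.assoc)
  have frac: "x / ennreal (s ^ (?n - 1)) = x / ennreal ((s / (1 + c)) ^ (?n - 1)) / ennreal ((1 + c) ^ (?n - 1))"
    if s: "0 < s" for x s
  proof -
    have "s ^ (?n - 1) = (s / (1 + c)) ^ (?n - 1) * (1 + c) ^ (?n - 1)"
      using c by (simp add: power_divide)
    then show ?thesis
      using s c by (simp add: divide_ennreal_def ennreal_mult ennreal_inverse_mult mult.assoc del: ennreal_power)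
  qed
  \<comment> \<open>Brings the term of \<open>L\<close> into the shape treated by
    \<open>frac\<close>, with \<open>s = 1\<close>.\<close>
  have one: "hausdorff_measure ?n L / m = hausdorff_measure ?n L / ennreal (1 ^ (?n - 1)) / m"
    by (simp add: divide_ennreal_def)
  have "hausdorff_measure ?n K / (ennreal (c ^ (?n - 1)) * m) + hausdorff_measure ?n L / m
     = h * (emeasure lborel K / ennreal ((c / (1 + c)) ^ (?n - 1))
        + emeasure lborel L / ennreal ((1 / (1 + c)) ^ (?n - 1))) / ennreal ((1 + c) ^ (?n - 1)) / m"
  proof -
    have "hausdorff_measure ?n K / (ennreal (c ^ (?n - 1)) * m)
      = hausdorff_measure ?n K / ennreal ((c / (1 + c)) ^ (?n - 1)) / ennreal ((1 + c) ^ (?n - 1)) / m"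
      unfolding frac[OF c, symmetric] using c by (intro div) simp
    moreover have "hausdorff_measure ?n L / m
      = hausdorff_measure ?n L / ennreal ((1 / (1 + c)) ^ (?n - 1)) / ennreal ((1 + c) ^ (?n - 1)) / m"
      unfolding one frac[OF zero_less_one, symmetric] ..
    ultimately show ?thesis
      unfolding hausdorff_measure_full[OF K'(1)] hausdorff_measure_full[OF L'(1)] h_def[symmetric]
      by (simp add: distrib_left add_divide_distrib_ennreal ennreal_times_divide del: ennreal_power)
  qed
  also have "\<dots> \<le> h * emeasure lborel (K + L) / ennreal ((1 + c) ^ (?n - 1)) / m"
    by (intro divide_right_mono_ennreal mult_left_mono
        emeasure_sum_homothetic_projections[OF K'(1,2) L' u c hom]) simp
  also have "\<dots> = hausdorff_measure ?n (K + L) / (ennreal ((1 + c) ^ (?n - 1)) * m)"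
    using c by (simp add: hausdorff_measure_full[OF compact_set_plus[OF K'(1) L'(1)]] h_def div
        del: ennreal_power)
  finally show ?thesis
    unfolding mK mKL m_def[symmetric] .
qed


text \<open>Length and height of the pyramid grow with its coordinate \<open>j\<close>, those of the
  box are constant. The sum therefore reaches furthest when the pyramid takes as much of that
  coordinate as it can, which is \<open>min 1 y\<close>; at most 1/4 remains for the box.\<close>

lemma tent_sum:
  fixes i j k :: "'n::finite"
  assumes ijk: "i \<noteq> j" "i \<noteq> k" "j \<noteq> k"
  shows "tent i j k (1/4) (\<lambda>_. 2) (\<lambda>_. 1) 1 + tent i j k 1 (\<lambda>y. y) (\<lambda>y. y) 1
    = tent i j k (5/4) (\<lambda>y. 2 + min 1 y) (\<lambda>y. 1 + min 1 y) 2" (is "?K + ?L = ?M")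
proof
  show "?K + ?L \<subseteq> ?M"
  proof
    fix z assume "z \<in> ?K + ?L"
    then obtain x y where xy: "x \<in> ?K" "y \<in> ?L" "z = x + y"
      by (rule set_plus_elim)
    then have "y $ j \<le> min 1 (x $ j + y $ j)"
      by (auto simp: tent_def)
    then show "z \<in> ?M"
      using xy by (force simp: tent_def)
  qed
  show "?M \<subseteq> ?K + ?L"
  proof
    fix z assume z: "z \<in> ?M"
    \<comment> \<open>In the directions \<open>j\<close>, \<open>i\<close> and \<open>k\<close> the
      pyramid gets the largest share it can hold and the excess fits into the box; in the others the
      two unit intervals share equally.\<close>
    define y :: "real ^ 'n" where "y = (\<chi> l. if l = j then min 1 (z $ j)
      else if l \<in> {i, k} then min (z $ l) (min 1 (z $ j)) else z $ l / 2)"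
    have "y \<in> ?L"
      using z ijk by (auto simp: tent_def y_def)
    moreover have "z - y \<in> ?K"
      using z ijk by (auto simp: tent_def y_def min_def)
    ultimately have "(z - y) + y \<in> ?K + ?L"
      by blast
    then show "z \<in> ?K + ?L"
      by simp
  qed
qed

lemma ratio_not_superadditive:
  assumes n: "3 \<le> CARD('n::finite)"
  obtains K L :: "(real ^ 'n) set" and u
  where "convex_body K" "convex_body L" "interior K \<noteq> {}" "interior L \<noteq> {}" "norm u = 1"
    "hausdorff_measure (CARD('n) - 1) (perp_proj u ` K) = hausdorff_measure (CARD('n) - 1) (perp_proj u ` L)"
    "hausdorff_measure (CARD('n) - 1) (perp_proj u ` K) \<noteq> 0"
    "hausdorff_measure CARD('n) (K + L) / hausdorff_measure (CARD('n) - 1) (perp_proj u ` (K + L))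
      < hausdorff_measure CARD('n) K / hausdorff_measure (CARD('n) - 1) (perp_proj u ` K)
        + hausdorff_measure CARD('n) L / hausdorff_measure (CARD('n) - 1) (perp_proj u ` L)"
proof -
  obtain T :: "'n set" where "card T = 3"
    using n obtain_subset_with_card_n[of 3 "UNIV :: 'n set"] by auto
  then obtain i j k :: 'n where ijk: "i \<noteq> j" "i \<noteq> k" "j \<noteq> k"
    unfolding card_3_iff by metis
  let ?n = "CARD('n)"
  let ?u = "axis k 1 :: real ^ 'n"
  let ?tent = "tent i j k"
  let ?K = "?tent (1/4) (\<lambda>_. 2) (\<lambda>_. 1) 1" and ?L = "?tent 1 (\<lambda>y. y) (\<lambda>y. y) 1"
  let ?M = "?tent (5/4) (\<lambda>y. 2 + min 1 y) (\<lambda>y. 1 + min 1 y) 2"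
  let ?R = "\<lambda>r. cbox 0 (\<chi> l. if l \<in> {i, j, k} then 1 else r) :: (real ^ 'n) set"
  \<comment> \<open>The volume of \<open>?R r\<close>. Only its positivity matters: within each
    ratio numerator and denominator contain the same \<open>\<rho> r\<close>.\<close>
  define \<rho> where "\<rho> r = (\<Prod>b\<in>Basis. (\<chi> l. if l \<in> {i, j, k} then 1 else r) \<bullet> (b :: real ^ 'n))" for r
  have pos: "0 < (\<chi> l. if l \<in> {i, j, k} then 1 else r) \<bullet> b" if r: "0 < r" and b: "b \<in> Basis"
    for r and b :: "real ^ 'n"
  proof -
    obtain l where "b = axis l 1"
      using b by (auto simp: Basis_vec_def)
    then show ?thesis
      using r by (simp add: inner_axis)
  qed
  have \<rho>: "emeasure lborel (?R r) = ennreal (\<rho> r)" "0 < \<rho> r" if "0 < r" for r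
  proof -
    show "0 < \<rho> r"
      unfolding \<rho>_def using pos[OF that] by (rule prod_pos)
    have "emeasure lborel (?R r) = ennreal (\<Prod>b\<in>Basis. ((\<chi> l. if l \<in> {i, j, k} then 1 else r) - 0) \<bullet> (b :: real ^ 'n))"
      by (rule emeasure_lborel_cbox) (use pos[OF that] in \<open>simp add: less_imp_le\<close>)
    then show "emeasure lborel (?R r) = ennreal (\<rho> r)"
      unfolding \<rho>_def by (simp only: diff_zero)
  qed
  have vol: "emeasure lborel (?tent b (\<lambda>y. \<alpha> + \<beta> * y) (\<lambda>y. \<gamma> + \<delta> * y) r)
      = ennreal (\<rho> r * (\<alpha> * \<gamma> * b + (\<alpha> * \<delta> + \<beta> * \<gamma>) * b^2 / 2 + \<beta> * \<delta> * b^3 / 3))"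
    if "0 \<le> \<alpha>" "0 \<le> \<beta>" "0 \<le> \<gamma>" "0 \<le> \<delta>" "0 \<le> b" "0 < r" for \<alpha> \<beta> \<gamma> \<delta> b r
  proof -
    have "emeasure lborel (?tent b (\<lambda>y. \<alpha> + \<beta> * y) (\<lambda>y. \<gamma> + \<delta> * y) r) = emeasure lborel (?R r) *
      (\<integral>\<^sup>+y. ennreal (\<alpha> + \<beta> * y) * ennreal (\<gamma> + \<delta> * y) * indicator {0..b} y \<partial>lborel)"
      by (rule emeasure_tent[OF ijk]) simp_all
    then show ?thesis
      unfolding \<rho>(1)[OF that(6)] nn_integral_affine_product[OF that(1-5)]
        ennreal_mult'[OF less_imp_le[OF \<rho>(2)[OF that(6)]]] .
  qed
  \<comment> \<open>The last summand is the plateau of width 1/4, where both profiles keep their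
    values at 1.\<close>
  have vol_trunc: "emeasure lborel (?tent (5/4) (\<lambda>y. \<alpha> + \<beta> * min 1 y) (\<lambda>y. \<gamma> + \<delta> * min 1 y) r)
      = ennreal (\<rho> r * (\<alpha> * \<gamma> + (\<alpha> * \<delta> + \<beta> * \<gamma>) / 2 + \<beta> * \<delta> / 3 + (\<alpha> + \<beta>) * (\<gamma> + \<delta>) / 4))"
    if nonneg: "0 \<le> \<alpha>" "0 \<le> \<beta>" "0 \<le> \<gamma>" "0 \<le> \<delta>" "0 < r" for \<alpha> \<beta> \<gamma> \<delta> r
  proof -
    have "(\<integral>\<^sup>+y. ennreal (\<alpha> + \<beta> * min 1 y) * ennreal (\<gamma> + \<delta> * min 1 y) * indicator {0..5/4} y \<partial>lborel)
      = ennreal (\<alpha> * \<gamma> + (\<alpha> * \<delta> + \<beta> * \<gamma>) / 2 + \<beta> * \<delta> / 3) + ennreal (\<alpha> + \<beta>) * ennreal (\<gamma> + \<delta>) * ennreal (1/4)"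
      using nn_integral_truncated[of "\<lambda>y. ennreal (\<alpha> + \<beta> * y) * ennreal (\<gamma> + \<delta> * y)" "5/4"]
        nn_integral_affine_product[of \<alpha> \<beta> \<gamma> \<delta> 1] nonneg by simp
    also have "\<dots> = ennreal (\<alpha> * \<gamma> + (\<alpha> * \<delta> + \<beta> * \<gamma>) / 2 + \<beta> * \<delta> / 3 + (\<alpha> + \<beta>) * (\<gamma> + \<delta>) / 4)"
      using nonneg by (simp add: ennreal_mult[symmetric] ennreal_plus[symmetric] del: ennreal_plus)
    finally have integral: "(\<integral>\<^sup>+y. ennreal (\<alpha> + \<beta> * min 1 y) * ennreal (\<gamma> + \<delta> * min 1 y) * indicator {0..5/4} y \<partial>lborel)
      = ennreal (\<alpha> * \<gamma> + (\<alpha> * \<delta> + \<beta> * \<gamma>) / 2 + \<beta> * \<delta> / 3 + (\<alpha> + \<beta>) * (\<gamma> + \<delta>) / 4)" .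
    have "emeasure lborel (?tent (5/4) (\<lambda>y. \<alpha> + \<beta> * min 1 y) (\<lambda>y. \<gamma> + \<delta> * min 1 y) r) = emeasure lborel (?R r) *
      (\<integral>\<^sup>+y. ennreal (\<alpha> + \<beta> * min 1 y) * ennreal (\<gamma> + \<delta> * min 1 y) * indicator {0..5/4} y \<partial>lborel)"
      by (rule emeasure_tent[OF ijk]) simp_all
    then show ?thesis
      unfolding integral \<rho>(1)[OF nonneg(5)] ennreal_mult'[OF less_imp_le[OF \<rho>(2)[OF nonneg(5)]]] .
  qed
  have cont: "continuous_on UNIV (\<lambda>y::real. 2 + min 1 y)" "continuous_on UNIV (\<lambda>y::real. 1 + min 1 y)"
    by (intro continuous_intros)+
  have cpt: "compact ?K" "compact ?L" "compact ?M"
    using cont by (auto intro!: compact_tent[OF ijk] continuous_intros)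
  \<comment> \<open>For the sum, the part over [0, 1] contributes 2 + 3/2 + 1/3 and the plateau 3 *
    2 / 4.\<close>
  have volumes: "emeasure lborel ?K = ennreal (\<rho> 1 / 2)" "emeasure lborel ?L = ennreal (\<rho> 1 / 3)"
      "emeasure lborel ?M = ennreal (\<rho> 2 * (16 / 3))"
    using vol[of 2 0 1 0 "1/4" 1] vol[of 0 1 0 1 1 1] vol_trunc[of 2 1 1 1 2] by simp_all
  obtain c where c: "hausdorff_measure ?n (coord_cube Basis (0 :: real ^ 'n) 1) = ennreal c" "0 < c"
    using hausdorff_measure_unit_cube_finite[of "Basis :: (real ^ 'n) set"]
      hausdorff_measure_unit_cube_pos[of "Basis :: (real ^ 'n) set"]
    by (cases "hausdorff_measure ?n (coord_cube Basis (0 :: real ^ 'n) 1)") auto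
  let ?B = "Basis - {?u}"
  have card: "card ?B = ?n - 1"
    by (subst card_Diff_singleton) (auto simp: axis_in_Basis_iff)
  obtain d where d: "hausdorff_measure (?n - 1) (coord_cube ?B 0 1) = ennreal d" "0 < d"
    using hausdorff_measure_unit_cube_finite[of ?B] hausdorff_measure_unit_cube_pos[of ?B] unfolding card
    by (cases "hausdorff_measure (?n - 1) (coord_cube ?B 0 1)") auto
  have full: "hausdorff_measure ?n A = ennreal (c * v)"
    if "compact A" "emeasure lborel A = ennreal v" for A :: "(real ^ 'n) set" and v
    using hausdorff_measure_full[OF that(1)] that(2) c by (simp add: ennreal_mult')
  have base: "hausdorff_measure (?n - 1) (perp_proj ?u ` ?tent b p q r) = ennreal (d * v)"
    if "continuous_on UNIV p" "\<And>y. y \<in> {0..b} \<Longrightarrow> 0 \<le> q y" "emeasure lborel (?tent b p (\<lambda>_. 1) r) = ennreal v"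
    for b p q r v
  proof -
    have "perp_proj ?u ` ?tent b p q r = ?tent b p (\<lambda>_. 0) r"
      by (rule perp_proj_tent[OF ijk]) (rule that(2))
    then show ?thesis
      using hausdorff_measure_base[OF ijk that(1), of b r] d(2)
      unfolding that(3) d(1) by (simp add: ennreal_mult')
  qed
  \<comment> \<open>Base areas are the same integrals with height 1, that is
    \<open>\<gamma> = 1\<close> and \<open>\<delta> = 0\<close>: 1/2 for box and pyramid alike, 5/2
    + 3/4 for the sum.\<close>
  have hK: "hausdorff_measure (?n - 1) (perp_proj ?u ` ?K) = ennreal (d * (\<rho> 1 / 2))"
    using vol[of 2 0 1 0 "1/4" 1] by (intro base) auto
  have hL: "hausdorff_measure (?n - 1) (perp_proj ?u ` ?L) = ennreal (d * (\<rho> 1 / 2))"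
    using vol[of 0 1 1 0 1 1] by (intro base continuous_intros) auto
  have hM: "hausdorff_measure (?n - 1) (perp_proj ?u ` ?M) = ennreal (d * (\<rho> 2 * (13 / 4)))"
    using vol_trunc[of 2 1 1 0 2] by (intro base cont) auto
  have \<rho>pos: "0 < \<rho> 1" "0 < \<rho> 2"
    using \<rho>(2) by auto
  have cvx: "convex ?K" "convex ?L"
    by (rule convex_tent[OF ijk]; simp add: concave_on_iff distrib_right[symmetric])+
  \<comment> \<open>A convex set with empty interior is negligible, so positive volume is
    enough.\<close>
  have interior: "interior A \<noteq> {}" if "convex A" "compact A" "emeasure lborel A = ennreal v" "0 < v"
    for A :: "(real ^ 'n) set" and v
  proof -
    have "emeasure lebesgue A \<noteq> 0"
      using that by (simp add: borel_closed compact_imp_closed)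
    then show ?thesis
      using negligible_convex_interior[OF that(1)] by (auto simp: negligible_iff_null_sets null_sets_def)
  qed
  \<comment> \<open>64/39 is 16/3 divided by 13/4; the factor \<open>c / d\<close> of the two
    dimension constants is common to all three ratios.\<close>
  have "hausdorff_measure ?n ?M / hausdorff_measure (?n - 1) (perp_proj ?u ` ?M) = ennreal (c / d * (64 / 39))"
    unfolding full[OF cpt(3) volumes(3)] hM using \<rho>pos c d by (subst divide_ennreal) auto
  also have "\<dots> < ennreal (c / d + c / d * (2 / 3))"
  proof -
    have "c / d * (64 / 39) < c / d * (5 / 3)"
      using c d by (intro mult_strict_left_mono) auto
    then show ?thesis
      using c d by (intro ennreal_lessI) (auto simp: field_simps)
  qed
  also have "\<dots> = hausdorff_measure ?n ?K / hausdorff_measure (?n - 1) (perp_proj ?u ` ?K)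
        + hausdorff_measure ?n ?L / hausdorff_measure (?n - 1) (perp_proj ?u ` ?L)"
    unfolding full[OF cpt(1) volumes(1)] full[OF cpt(2) volumes(2)] hK hL
    using \<rho>pos c d by (simp add: divide_ennreal ennreal_plus[symmetric] del: ennreal_plus)
  finally have less: "hausdorff_measure ?n (?K + ?L) / hausdorff_measure (?n - 1) (perp_proj ?u ` (?K + ?L))
      < hausdorff_measure ?n ?K / hausdorff_measure (?n - 1) (perp_proj ?u ` ?K)
        + hausdorff_measure ?n ?L / hausdorff_measure (?n - 1) (perp_proj ?u ` ?L)"
    unfolding tent_sum[OF ijk] .
  have body: "convex_body ?K" "convex_body ?L"
    unfolding convex_body_def using cpt cvx interior_subset
      interior[OF cvx(1) cpt(1) volumes(1)] interior[OF cvx(2) cpt(2) volumes(2)] \<rho>pos by auto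
  have eq: "hausdorff_measure (?n - 1) (perp_proj ?u ` ?K) = hausdorff_measure (?n - 1) (perp_proj ?u ` ?L)"
    unfolding hK hL ..
  have ne: "hausdorff_measure (?n - 1) (perp_proj ?u ` ?K) \<noteq> 0"
    unfolding hK using \<rho>pos d by simp
  show thesis
    using \<rho>pos
    by (intro that[OF body interior[OF cvx(1) cpt(1) volumes(1)] interior[OF cvx(2) cpt(2) volumes(2)]
        norm_axis_1 eq ne less]) simp_all
qed

theorem theorem4:
  assumes "CARD('n::finite) \<ge> 3"
  shows
    "(\<forall>(u :: real ^ 'n) K L.
        u \<in> sphere 0 1 \<longrightarrow> convex_body K \<longrightarrow> convex_body L \<longrightarrow>
        aff_dim (perp_proj u ` K) = int CARD('n) - 1 \<longrightarrow>
        aff_dim (perp_proj u ` L) = int CARD('n) - 1 \<longrightarrow>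
        homothetic_sets (perp_proj u ` K) (perp_proj u ` L) \<longrightarrow>
        hausdorff_measure CARD('n) (K + L) / hausdorff_measure (CARD('n) - 1) (perp_proj u ` (K + L))
        \<ge> hausdorff_measure CARD('n) K / hausdorff_measure (CARD('n) - 1) (perp_proj u ` K)
          + hausdorff_measure CARD('n) L / hausdorff_measure (CARD('n) - 1) (perp_proj u ` L))
     \<and>
     (\<exists>(K :: (real ^ 'n) set) L u.
        convex_body K \<and> convex_body L \<and> interior K \<noteq> {} \<and> interior L \<noteq> {} \<and>
        u \<in> sphere 0 1 \<and>
        hausdorff_measure (CARD('n) - 1) (perp_proj u ` K)
          = hausdorff_measure (CARD('n) - 1) (perp_proj u ` L) \<and>
        hausdorff_measure (CARD('n) - 1) (perp_proj u ` K) \<noteq> 0 \<and>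
        \<not> (hausdorff_measure CARD('n) (K + L) / hausdorff_measure (CARD('n) - 1) (perp_proj u ` (K + L))
           \<ge> hausdorff_measure CARD('n) K / hausdorff_measure (CARD('n) - 1) (perp_proj u ` K)
             + hausdorff_measure CARD('n) L / hausdorff_measure (CARD('n) - 1) (perp_proj u ` L)))"
proof (intro conjI allI impI)
  fix u :: "real ^ 'n" and K L
  assume "u \<in> sphere 0 1" "convex_body K" "convex_body L"
    "homothetic_sets (perp_proj u ` K) (perp_proj u ` L)"
  then show "hausdorff_measure CARD('n) (K + L) / hausdorff_measure (CARD('n) - 1) (perp_proj u ` (K + L))
        \<ge> hausdorff_measure CARD('n) K / hausdorff_measure (CARD('n) - 1) (perp_proj u ` K)
          + hausdorff_measure CARD('n) L / hausdorff_measure (CARD('n) - 1) (perp_proj u ` L)"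
    using ratio_superadditive[of u K L] by simp
next
  obtain K L :: "(real ^ 'n) set" and u where
    "convex_body K" "convex_body L" "interior K \<noteq> {}" "interior L \<noteq> {}" "norm u = 1"
    "hausdorff_measure (CARD('n) - 1) (perp_proj u ` K) = hausdorff_measure (CARD('n) - 1) (perp_proj u ` L)"
    "hausdorff_measure (CARD('n) - 1) (perp_proj u ` K) \<noteq> 0"
    "hausdorff_measure CARD('n) (K + L) / hausdorff_measure (CARD('n) - 1) (perp_proj u ` (K + L))
      < hausdorff_measure CARD('n) K / hausdorff_measure (CARD('n) - 1) (perp_proj u ` K)
        + hausdorff_measure CARD('n) L / hausdorff_measure (CARD('n) - 1) (perp_proj u ` L)"
    using ratio_not_superadditive[OF assms] by blast
  then show "\<exists>(K :: (real ^ 'n) set) L u.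
        convex_body K \<and> convex_body L \<and> interior K \<noteq> {} \<and> interior L \<noteq> {} \<and>
        u \<in> sphere 0 1 \<and>
        hausdorff_measure (CARD('n) - 1) (perp_proj u ` K)
          = hausdorff_measure (CARD('n) - 1) (perp_proj u ` L) \<and>
        hausdorff_measure (CARD('n) - 1) (perp_proj u ` K) \<noteq> 0 \<and>
        \<not> (hausdorff_measure CARD('n) (K + L) / hausdorff_measure (CARD('n) - 1) (perp_proj u ` (K + L))
           \<ge> hausdorff_measure CARD('n) K / hausdorff_measure (CARD('n) - 1) (perp_proj u ` K)
             + hausdorff_measure CARD('n) L / hausdorff_measure (CARD('n) - 1) (perp_proj u ` L))"
    unfolding mem_sphere_0 not_le by blast
qed

end
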